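(* Let $G$ be a topological group such that $\ell(G)=0$. Then $G$ is extremely amenable.
   Context: For a topological group $G$, $\mathrm{RUCB}(G)$ is the algebra of all bounded functions $f\colon G\to\mathbb{R}$ such that for every $\epsilon>0$ there is a neighborhood $U$ of $e$ with $\sup_{x\in G}|f(x)-f(gx)|\le\epsilon$ for all $g\in U$. $G$ is amenable if there is a positive unital linear functional $\mu$ on $\mathrm{RUCB}(G)$ with $\mu(f\circ\lambda_g)=\mu(f)$ for all $f\in\mathrm{RUCB}(G)$, $g\in G$, where $\lambda_g(x)=gx$. $G$ is extremely amenable if every (jointly) continuous action of $G$ on a non-empty compact Hausdorff space has a fixed point. Subgroups carry the relative topology. Amenable length. $\Delta(G)$ is the set of all bounded, continuous, right-invariant pseudo-metrics on $G$ (continuous: the generated topology is contained in that of $G$; right-invariant: $d(xg,yg)=d(x,y)$). $\mathscr{A}(G)$ is the set of all amenable topological subgroups of $G$, and $\mathscr{A}^*(G)$ is the set of all finite tuples $(G_0,\dots,G_n)$, $n\in\mathbb{N}$, of members of $\mathscr{A}(G)$ with $\{e\}=G_0\le\dots\le G_n=G$. For $d\in\Delta(G)$ and $(G_0,\dots,G_n)\in\mathscr{A}^*(G)$ let $$\ell(G_0,\dots,G_n;d):=\Bigl(\sum_{i=0}^{n-1}\bigl(\sup_{g\in G}\operatorname{diam}(G_{i+1}/G_i,d_i^g)\bigr)^2\Bigr)^{1/2},\qquad d_i^g(xG_i,yG_i):=\inf_{h\in G_i}d(gx,gyh),$$ and let $\ell(G,d):=\inf\{\ell(G_0,\dots,G_n;d)\mid(G_0,\dots,G_n)\in\mathscr{A}^*(G)\}\in[0,\infty]$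 (with $\inf\emptyset=\infty$). For a neighborhood $U$ of $e$ in $G$ and a finite subset $F\subseteq G$, let $\mathrm{T}_G(U,F)$ be the set of all pairs $(H,d)$ with $H\in\mathscr{A}(G)$, $d\in\Delta(H)$, $F\subseteq UH$ and $\{x\in H\mid d(e,x)<1\}\subseteq U$. Then $$\ell(G):=\sup\Bigl\{\inf_{(H,d)\in\mathrm{T}_G(U,F)}\ell(H,d)\ \Big|\ U\text{ neighborhood of }e,\ F\subseteq G\text{ finite}\Bigr\}\in[0,\infty].$$ *)

theory Defs
  imports "HOL-Analysis.Analysis" "HOL-Algebra.Group_Action"
begin

text \<open>
  A topological group is a group \<open>G\<close> together with an abstract topology \<open>T\<close> whose underlying set
  is the carrier of \<open>G\<close>; no separation axiom is imposed. A subgroup \<open>H\<close> with its relative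
  topology is the pair \<open>G\<lparr>carrier := H\<rparr>\<close>, \<open>subtopology T H\<close>.
\<close>

locale topological_group = group G for G (structure) +
  fixes T :: "'a topology"
  assumes topspace_eq: "topspace T = carrier G"
    and continuous_mult: "continuous_map (prod_topology T T) T (\<lambda>(x, y). x \<otimes> y)"
    and continuous_inv: "continuous_map T T (\<lambda>x. inv x)"

definition neighborhood :: "'a topology \<Rightarrow> 'a \<Rightarrow> 'a set \<Rightarrow> bool" where
  "neighborhood T x U \<longleftrightarrow> U \<subseteq> topspace T \<and> (\<exists>V. openin T V \<and> x \<in> V \<and> V \<subseteq> U)"

subsection \<open>Amenability and extreme amenability\<close>

text \<open>
  Real functions on the group are represented by functions that are extensional on the carrier.
\<close>

definition RUCB :: "('a, 'b) monoid_scheme \<Rightarrow> 'a topology \<Rightarrow> ('a \<Rightarrow> real) set" where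
  "RUCB G T = {f \<in> extensional (carrier G).
     bounded (f ` carrier G) \<and>
     (\<forall>\<epsilon>>0. \<exists>U. neighborhood T \<one>\<^bsub>G\<^esub> U \<and>
        (\<forall>g\<in>U. (SUP x\<in>carrier G. \<bar>f x - f (g \<otimes>\<^bsub>G\<^esub> x)\<bar>) \<le> \<epsilon>))}"

definition amenable :: "('a, 'b) monoid_scheme \<Rightarrow> 'a topology \<Rightarrow> bool" where
  "amenable G T \<longleftrightarrow> (\<exists>\<mu> :: ('a \<Rightarrow> real) \<Rightarrow> real.
     (\<forall>f\<in>RUCB G T. \<forall>h\<in>RUCB G T. \<mu> (\<lambda>x\<in>carrier G. f x + h x) = \<mu> f + \<mu> h) \<and>
     (\<forall>c. \<forall>f\<in>RUCB G T. \<mu> (\<lambda>x\<in>carrier G. c * f x) = c * \<mu> f) \<and>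
     (\<forall>f\<in>RUCB G T. (\<forall>x\<in>carrier G. 0 \<le> f x) \<longrightarrow> 0 \<le> \<mu> f) \<and>
     \<mu> (\<lambda>x\<in>carrier G. 1) = 1 \<and>
     (\<forall>f\<in>RUCB G T. \<forall>g\<in>carrier G. \<mu> (\<lambda>x\<in>carrier G. f (g \<otimes>\<^bsub>G\<^esub> x)) = \<mu> f))"

text \<open>
  HOL cannot quantify over types inside a formula, so the type \<open>'x\<close> carrying the compact spaces is
  a parameter. A theorem stated with a free type variable \<open>'x\<close> holds for spaces over every type.
\<close>

definition extremely_amenable ::
  "'x itself \<Rightarrow> ('a, 'b) monoid_scheme \<Rightarrow> 'a topology \<Rightarrow> bool" where
  "extremely_amenable (_ :: 'x itself) G T \<longleftrightarrow>
     (\<forall>(X :: 'x topology) \<phi>.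
        compact_space X \<and> Hausdorff_space X \<and> topspace X \<noteq> {} \<and>
        group_action G (topspace X) \<phi> \<and>
        continuous_map (prod_topology T X) X (\<lambda>(g, x). \<phi> g x)
        \<longrightarrow> (\<exists>x\<in>topspace X. \<forall>g\<in>carrier G. \<phi> g x = x))"

subsection \<open>Amenable length\<close>

definition pseudo_metric_on :: "'a set \<Rightarrow> ('a \<Rightarrow> 'a \<Rightarrow> real) \<Rightarrow> bool" where
  "pseudo_metric_on S d \<longleftrightarrow>
     (\<forall>x\<in>S. \<forall>y\<in>S. 0 \<le> d x y) \<and>
     (\<forall>x\<in>S. d x x = 0) \<and>
     (\<forall>x\<in>S. \<forall>y\<in>S. d x y = d y x) \<and>
     (\<forall>x\<in>S. \<forall>y\<in>S. \<forall>z\<in>S. d x z \<le> d x y + d y z)"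

definition pseudo_metric_topology :: "'a set \<Rightarrow> ('a \<Rightarrow> 'a \<Rightarrow> real) \<Rightarrow> 'a topology" where
  "pseudo_metric_topology S d =
     topology_generated_by {{y \<in> S. d x y < r} | x r. x \<in> S \<and> 0 < r}"

text \<open>Values of \<open>d\<close> outside the carrier are irrelevant throughout.\<close>

definition Delta :: "('a, 'b) monoid_scheme \<Rightarrow> 'a topology \<Rightarrow> ('a \<Rightarrow> 'a \<Rightarrow> real) set" where
  "Delta G T = {d. pseudo_metric_on (carrier G) d \<and>
     (\<exists>B. \<forall>x\<in>carrier G. \<forall>y\<in>carrier G. d x y \<le> B) \<and>
     (\<forall>U. openin (pseudo_metric_topology (carrier G) d) U \<longrightarrow> openin T U) \<and>
     (\<forall>x\<in>carrier G. \<forall>y\<in>carrier G. \<forall>g\<in>carrier G.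
        d (x \<otimes>\<^bsub>G\<^esub> g) (y \<otimes>\<^bsub>G\<^esub> g) = d x y)}"

definition amenable_subgroups :: "('a, 'b) monoid_scheme \<Rightarrow> 'a topology \<Rightarrow> 'a set set" where
  "amenable_subgroups G T =
     {H. subgroup H G \<and> amenable (G\<lparr>carrier := H\<rparr>) (subtopology T H)}"

text \<open>The tuple \<open>(G\<^sub>0, \<dots>, G\<^sub>n)\<close> is a list of length \<open>n + 1\<close>.\<close>

definition amenable_chains :: "('a, 'b) monoid_scheme \<Rightarrow> 'a topology \<Rightarrow> 'a set list set" where
  "amenable_chains G T = {Gs. Gs \<noteq> [] \<and> set Gs \<subseteq> amenable_subgroups G T \<and>
     hd Gs = {\<one>\<^bsub>G\<^esub>} \<and> last Gs = carrier G \<and>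
     (\<forall>i < length Gs - 1. Gs ! i \<subseteq> Gs ! Suc i)}"

text \<open>
  The distance between the left cosets \<open>xH\<close> and \<open>yH\<close> in terms of representatives; for
  right-invariant \<open>d\<close> it only depends on the cosets (lemma \<open>coset_dist_cong\<close> below).
\<close>

definition coset_dist ::
  "('a, 'b) monoid_scheme \<Rightarrow> ('a \<Rightarrow> 'a \<Rightarrow> real) \<Rightarrow> 'a set \<Rightarrow> 'a \<Rightarrow> 'a \<Rightarrow> 'a \<Rightarrow> real" where
  "coset_dist G d H g x y = (INF h\<in>H. d (g \<otimes>\<^bsub>G\<^esub> x) (g \<otimes>\<^bsub>G\<^esub> y \<otimes>\<^bsub>G\<^esub> h))"

lemma (in group) coset_dist_cong:
  assumes d: "d \<in> Delta G T" and H: "subgroup H G"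
    and g: "g \<in> carrier G" and x: "x \<in> carrier G" and y: "y \<in> carrier G"
    and x': "x' \<in> x <# H" and y': "y' \<in> y <# H"
  shows "coset_dist G d H g x' y' = coset_dist G d H g x y"
proof -
  obtain a where a: "a \<in> H" "x' = x \<otimes> a" using x' by (auto simp: l_coset_def)
  obtain b where b: "b \<in> H" "y' = y \<otimes> b" using y' by (auto simp: l_coset_def)
  have ac: "a \<in> carrier G" and bc: "b \<in> carrier G"
    using a b H by (auto simp: subgroup.mem_carrier)
  have inv: "d (u \<otimes> w) (v \<otimes> w) = d u v"
    if "u \<in> carrier G" "v \<in> carrier G" "w \<in> carrier G" for u v w
    using d that by (auto simp: Delta_def)
  have bij: "(\<lambda>h. b \<otimes> h \<otimes> inv a) ` H = H"
  proof
    show "(\<lambda>h. b \<otimes> h \<otimes> inv a) ` H \<subseteq> H"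
      using a b H by (auto intro!: subgroup.m_closed subgroup.m_inv_closed)
    show "H \<subseteq> (\<lambda>h. b \<otimes> h \<otimes> inv a) ` H"
    proof
      fix h assume h: "h \<in> H"
      have hc: "h \<in> carrier G" using h H by (simp add: subgroup.mem_carrier)
      have "h = b \<otimes> (inv b \<otimes> h \<otimes> a) \<otimes> inv a"
      proof -
        have "b \<otimes> (inv b \<otimes> h \<otimes> a) = h \<otimes> a"
          using ac bc hc by (simp flip: m_assoc)
        then show ?thesis
          using ac hc by (simp add: m_assoc)
      qed
      moreover have "inv b \<otimes> h \<otimes> a \<in> H"
        using a b h H by (auto intro!: subgroup.m_closed subgroup.m_inv_closed)
      ultimately show "h \<in> (\<lambda>h. b \<otimes> h \<otimes> inv a) ` H" by blast
    qed
  qed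
  have "d (g \<otimes> x') (g \<otimes> y' \<otimes> h) = d (g \<otimes> x) (g \<otimes> y \<otimes> (b \<otimes> h \<otimes> inv a))"
    if h: "h \<in> H" for h
  proof -
    have hc: "h \<in> carrier G" using h H by (simp add: subgroup.mem_carrier)
    have "d (g \<otimes> x') (g \<otimes> y' \<otimes> h) = d (g \<otimes> x' \<otimes> inv a) (g \<otimes> y' \<otimes> h \<otimes> inv a)"
      using a b g x y ac bc hc by (subst inv) auto
    also have "g \<otimes> x' \<otimes> inv a = g \<otimes> x"
      using a g x ac by (simp add: m_assoc)
    also have "g \<otimes> y' \<otimes> h \<otimes> inv a = g \<otimes> y \<otimes> (b \<otimes> h \<otimes> inv a)"
      using b g y ac bc hc by (simp add: m_assoc)
    finally show ?thesis .
  qed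
  then have "coset_dist G d H g x' y' =
      (INF h\<in>H. d (g \<otimes> x) (g \<otimes> y \<otimes> (b \<otimes> h \<otimes> inv a)))"
    by (simp add: coset_dist_def cong: INF_cong_simp)
  also have "\<dots> = (INF h\<in>(\<lambda>h. b \<otimes> h \<otimes> inv a) ` H. d (g \<otimes> x) (g \<otimes> y \<otimes> h))"
    by (simp add: image_image)
  finally show ?thesis
    by (simp only: bij coset_dist_def)
qed

text \<open>The diameter of \<open>K/H\<close>, with \<open>x\<close> and \<open>y\<close> ranging over representatives of the cosets.\<close>

definition quotient_diam ::
  "('a, 'b) monoid_scheme \<Rightarrow> ('a \<Rightarrow> 'a \<Rightarrow> real) \<Rightarrow> 'a set \<Rightarrow> 'a set \<Rightarrow> 'a \<Rightarrow> real" where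
  "quotient_diam G d K H g = (SUP (x, y) \<in> K \<times> K. coset_dist G d H g x y)"

text \<open>
  For \<open>d\<close> in \<open>Delta G T\<close> the real suprema and infima involved are over nonempty bounded sets.
\<close>

definition chain_length ::
  "('a, 'b) monoid_scheme \<Rightarrow> ('a \<Rightarrow> 'a \<Rightarrow> real) \<Rightarrow> 'a set list \<Rightarrow> real" where
  "chain_length G d Gs =
     sqrt (\<Sum>i < length Gs - 1.
       (SUP g\<in>carrier G. quotient_diam G d (Gs ! Suc i) (Gs ! i) g)\<^sup>2)"

definition metric_amenable_length ::
  "('a, 'b) monoid_scheme \<Rightarrow> 'a topology \<Rightarrow> ('a \<Rightarrow> 'a \<Rightarrow> real) \<Rightarrow> ennreal" where
  "metric_amenable_length G T d =
     (INF Gs\<in>amenable_chains G T. ennreal (chain_length G d Gs))"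

definition T_set ::
  "('a, 'b) monoid_scheme \<Rightarrow> 'a topology \<Rightarrow> 'a set \<Rightarrow> 'a set \<Rightarrow> ('a set \<times> ('a \<Rightarrow> 'a \<Rightarrow> real)) set" where
  "T_set G T U F = {(H, d).
     H \<in> amenable_subgroups G T \<and>
     d \<in> Delta (G\<lparr>carrier := H\<rparr>) (subtopology T H) \<and>
     F \<subseteq> U <#>\<^bsub>G\<^esub> H \<and>
     {x \<in> H. d \<one>\<^bsub>G\<^esub> x < 1} \<subseteq> U}"

definition amenable_length :: "('a, 'b) monoid_scheme \<Rightarrow> 'a topology \<Rightarrow> ennreal" where
  "amenable_length G T =
     (SUP (U, F) \<in> {(U, F). neighborhood T \<one>\<^bsub>G\<^esub> U \<and> finite F \<and> F \<subseteq> carrier G}.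
        INF (H, d) \<in> T_set G T U F.
          metric_amenable_length (G\<lparr>carrier := H\<rparr>) (subtopology T H) d)"

end

theory Submission
  imports Defs
begin

text \<open>
  Along a chain \<open>{e} = G\<^sub>0 \<le> \<dots> \<le> G\<^sub>n = H\<close> of amenable groups one composes the invariant means: from
  \<open>\<nu>\<close> on \<open>G\<^sub>i\<close> and \<open>\<mu>\<close> on \<open>G\<^sub>i\<^sub>+\<^sub>1\<close> one gets the mean \<open>f \<mapsto> \<mu> (x \<mapsto> \<nu> (h \<mapsto> f (x h)))\<close>. For a
  1-Lipschitz \<open>f\<close> the inner average is right \<open>G\<^sub>i\<close>-invariant, so its oscillation is at most the diameter
  of \<open>G\<^sub>i\<^sub>+\<^sub>1/G\<^sub>i\<close>, and by the orthogonality of martingale differences the variance of \<open>f\<close> is at most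
  \<open>\<ell>(G\<^sub>0, \<dots>, G\<^sub>n; d)\<^sup>2\<close>. If \<open>\<ell>(G) = 0\<close>, finitely many right-uniformly continuous functions on \<open>G\<close> are
  uniformly close, on a suitable \<open>H\<close>, to 1-Lipschitz functions of tiny variance, hence to functions
  nearly constant in mean; as the mean is invariant, some point is almost fixed by any given finite
  set of translations. Applied to orbit maps composed with Urysohn functions, this contradicts the
  absence of a fixed point, by compactness.
\<close>

section \<open>Preliminaries on means, balls and neighborhoods\<close>

text \<open>The functional whose existence \<open>amenable\<close> asserts gets a predicate of its
  own, so that concrete means can be composed and followed along a chain.\<close>

definition invariant_mean ::
  "('a, 'b) monoid_scheme \<Rightarrow> 'a topology \<Rightarrow> (('a \<Rightarrow> real) \<Rightarrow> real) \<Rightarrow> bool" where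
  "invariant_mean G T \<mu> \<longleftrightarrow>
     (\<forall>f\<in>RUCB G T. \<forall>h\<in>RUCB G T. \<mu> (\<lambda>x\<in>carrier G. f x + h x) = \<mu> f + \<mu> h) \<and>
     (\<forall>c. \<forall>f\<in>RUCB G T. \<mu> (\<lambda>x\<in>carrier G. c * f x) = c * \<mu> f) \<and>
     (\<forall>f\<in>RUCB G T. (\<forall>x\<in>carrier G. 0 \<le> f x) \<longrightarrow> 0 \<le> \<mu> f) \<and>
     \<mu> (\<lambda>x\<in>carrier G. 1) = 1 \<and>
     (\<forall>f\<in>RUCB G T. \<forall>g\<in>carrier G. \<mu> (\<lambda>x\<in>carrier G. f (g \<otimes>\<^bsub>G\<^esub> x)) = \<mu> f)"

lemma amenable_iff_invariant_mean: "amenable G T \<longleftrightarrow> (\<exists>\<mu>. invariant_mean G T \<mu>)"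
  unfolding amenable_def invariant_mean_def ..

lemma pseudo_metric_ball_open:
  assumes "d \<in> Delta G T" "x \<in> carrier G" "0 < r"
  shows "openin T {y \<in> carrier G. d x y < r}"
proof -
  have "openin (pseudo_metric_topology (carrier G) d) {y \<in> carrier G. d x y < r}"
    unfolding pseudo_metric_topology_def using assms
    by (intro topology_generated_by_Basis) blast
  then show ?thesis using assms(1) by (auto simp: Delta_def)
qed

lemma neighborhood_Int:
  assumes "neighborhood T x U" "neighborhood T x V"
  shows "neighborhood T x (U \<inter> V)"
proof -
  obtain U' V' where "openin T U'" "x \<in> U'" "U' \<subseteq> U" "openin T V'" "x \<in> V'" "V' \<subseteq> V"
    using assms by (auto simp: neighborhood_def)
  then have "openin T (U' \<inter> V')" "x \<in> U' \<inter> V'" "U' \<inter> V' \<subseteq> U \<inter> V" by auto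
  with assms show ?thesis unfolding neighborhood_def by blast
qed

lemma neighborhood_INT:
  assumes "finite I" "x \<in> topspace T" "\<And>i. i \<in> I \<Longrightarrow> neighborhood T x (U i)"
  shows "\<exists>V. neighborhood T x V \<and> (\<forall>i\<in>I. V \<subseteq> U i)"
  using assms
proof (induction I rule: finite_induct)
  case empty
  then show ?case by (intro exI[of _ "topspace T"]) (auto simp: neighborhood_def)
next
  case (insert i I)
  then obtain V where "neighborhood T x V" "\<forall>i\<in>I. V \<subseteq> U i" by auto
  then show ?case using insert.prems neighborhood_Int[of T x V "U i"]
    by (intro exI[of _ "V \<inter> U i"]) auto
qed

section \<open>Right-uniformly continuous functions\<close>

context topological_group
begin

lemma openin_conjugation_preimage:
  assumes x: "x \<in> carrier G" and V: "openin T V"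
  shows "openin T {g \<in> carrier G. x \<otimes> g \<otimes> inv x \<in> V}"
proof -
  have mult: "continuous_map T T (\<lambda>g. a g \<otimes> b g)"
    if "continuous_map T T a" "continuous_map T T b" for a b
    using continuous_map_compose[OF continuous_map_pairedI[OF that] continuous_mult]
    by (simp add: o_def)
  have "continuous_map T T (\<lambda>g. x \<otimes> g \<otimes> inv x)"
    using x by (intro mult) (auto simp: topspace_eq)
  from openin_continuous_map_preimage[OF this V] show ?thesis by (simp add: topspace_eq)
qed

lemma topological_group_subgroup:
  assumes K: "subgroup K G"
  shows "topological_group (G\<lparr>carrier := K\<rparr>) (subtopology T K)"
proof (intro topological_group.intro topological_group_axioms.intro)
  have sub: "K \<subseteq> carrier G" using K by (rule subgroup.subset)
  show "group (G\<lparr>carrier := K\<rparr>)" using K by (rule subgroup_imp_group)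
  show "topspace (subtopology T K) = carrier (G\<lparr>carrier := K\<rparr>)"
    using sub by (auto simp: topspace_eq)
  have "continuous_map (subtopology (prod_topology T T) (K \<times> K)) (subtopology T K)
      (\<lambda>(x, y). x \<otimes> y)"
    using continuous_map_from_subtopology[OF continuous_mult] K
    by (auto simp: continuous_map_in_subtopology subgroup.m_closed)
  then show "continuous_map (prod_topology (subtopology T K) (subtopology T K)) (subtopology T K)
      (\<lambda>(x, y). x \<otimes>\<^bsub>G\<lparr>carrier := K\<rparr>\<^esub> y)"
    by (simp add: subtopology_Times)
  have "continuous_map (subtopology T K) (subtopology T K) (\<lambda>x. inv x)"
    using continuous_map_from_subtopology[OF continuous_inv] K
    by (auto simp: continuous_map_in_subtopology subgroup.m_inv_closed)
  then show "continuous_map (subtopology T K) (subtopology T K)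
      (\<lambda>x. inv\<^bsub>G\<lparr>carrier := K\<rparr>\<^esub> x)"
    by (rule continuous_map_eq) (use K sub in \<open>auto simp: m_inv_consistent\<close>)
qed

lemma neighborhood_carrier:
  "neighborhood T \<one> U \<Longrightarrow> g \<in> U \<Longrightarrow> g \<in> carrier G"
  by (auto simp: neighborhood_def topspace_eq)

text \<open>Boundedness of \<open>f\<close> bounds the family under the \<open>SUP\<close>, so the
  real supremum is a genuine one and an upper estimate for it can be read pointwise.\<close>

lemma RUCB_iff:
  "f \<in> RUCB G T \<longleftrightarrow> f \<in> extensional (carrier G) \<and>
     (\<exists>B. \<forall>x\<in>carrier G. \<bar>f x\<bar> \<le> B) \<and>
     (\<forall>\<epsilon>>0. \<exists>U. neighborhood T \<one> U \<and> (\<forall>g\<in>U. \<forall>x\<in>carrier G. \<bar>f x - f (g \<otimes> x)\<bar> \<le> \<epsilon>))"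
proof -
  have "(SUP x\<in>carrier G. \<bar>f x - f (g \<otimes> x)\<bar>) \<le> \<epsilon> \<longleftrightarrow>
      (\<forall>x\<in>carrier G. \<bar>f x - f (g \<otimes> x)\<bar> \<le> \<epsilon>)"
    if B: "\<forall>x\<in>carrier G. \<bar>f x\<bar> \<le> B" and g: "g \<in> carrier G" for B g \<epsilon>
  proof (rule cSUP_le_iff)
    show "bdd_above ((\<lambda>x. \<bar>f x - f (g \<otimes> x)\<bar>) ` carrier G)"
    proof (rule bdd_aboveI2)
      fix x assume x: "x \<in> carrier G"
      have "\<bar>f x\<bar> \<le> B" "\<bar>f (g \<otimes> x)\<bar> \<le> B" using x g B by auto
      then show "\<bar>f x - f (g \<otimes> x)\<bar> \<le> B + B" by linarith
    qed
  qed auto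
  then have *: "(\<forall>g\<in>U. (SUP x\<in>carrier G. \<bar>f x - f (g \<otimes> x)\<bar>) \<le> \<epsilon>) \<longleftrightarrow>
      (\<forall>g\<in>U. \<forall>x\<in>carrier G. \<bar>f x - f (g \<otimes> x)\<bar> \<le> \<epsilon>)"
    if "\<forall>x\<in>carrier G. \<bar>f x\<bar> \<le> B" and "neighborhood T \<one> U" for B U \<epsilon>
    using that neighborhood_carrier by meson
  have "bounded (f ` carrier G) \<longleftrightarrow> (\<exists>B. \<forall>x\<in>carrier G. \<bar>f x\<bar> \<le> B)"
    by (auto simp: bounded_iff)
  then show ?thesis unfolding RUCB_def mem_Collect_eq using * by meson
qed

lemma RUCB_I:
  assumes "\<And>x. x \<in> carrier G \<Longrightarrow> \<bar>f x\<bar> \<le> B"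
    and "\<And>\<epsilon>. 0 < \<epsilon> \<Longrightarrow>
      \<exists>U. neighborhood T \<one> U \<and> (\<forall>g\<in>U. \<forall>x\<in>carrier G. \<bar>f x - f (g \<otimes> x)\<bar> \<le> \<epsilon>)"
  shows "(\<lambda>x\<in>carrier G. f x) \<in> RUCB G T"
  unfolding RUCB_iff
proof (intro conjI allI impI)
  show "\<exists>B. \<forall>x\<in>carrier G. \<bar>(\<lambda>x\<in>carrier G. f x) x\<bar> \<le> B" using assms(1) by auto
next
  fix \<epsilon> :: real assume "0 < \<epsilon>"
  then obtain U where "neighborhood T \<one> U" "\<forall>g\<in>U. \<forall>x\<in>carrier G. \<bar>f x - f (g \<otimes> x)\<bar> \<le> \<epsilon>"
    using assms(2) by blast
  then show "\<exists>U. neighborhood T \<one> U \<and> (\<forall>g\<in>U. \<forall>x\<in>carrier G.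
      \<bar>(\<lambda>x\<in>carrier G. f x) x - (\<lambda>x\<in>carrier G. f x) (g \<otimes> x)\<bar> \<le> \<epsilon>)"
    using neighborhood_carrier by (intro exI[of _ U]) auto
qed auto

lemma RUCB_bounded:
  assumes "f \<in> RUCB G T" obtains B where "0 < B" "\<And>x. x \<in> carrier G \<Longrightarrow> \<bar>f x\<bar> \<le> B"
proof -
  obtain B where B: "\<forall>x\<in>carrier G. \<bar>f x\<bar> \<le> B" using assms unfolding RUCB_iff by blast
  show ?thesis by (rule that[of "max B 1"]) (use B in \<open>auto simp: le_max_iff_disj\<close>)
qed

lemma RUCB_uniform:
  assumes "f \<in> RUCB G T" "0 < \<epsilon>"
  obtains U where "neighborhood T \<one> U"
    "\<And>g x. g \<in> U \<Longrightarrow> x \<in> carrier G \<Longrightarrow> \<bar>f x - f (g \<otimes> x)\<bar> \<le> \<epsilon>"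
  using assms unfolding RUCB_iff by blast

lemma RUCB_const: "(\<lambda>x\<in>carrier G. c) \<in> RUCB G T"
proof (rule RUCB_I)
  show "\<exists>U. neighborhood T \<one> U \<and> (\<forall>g\<in>U. \<forall>x\<in>carrier G. \<bar>c - c\<bar> \<le> \<epsilon>)"
    if "0 < \<epsilon>" for \<epsilon> :: real
    using that one_closed openin_topspace[of T]
    by (intro exI[of _ "carrier G"]) (auto simp: neighborhood_def topspace_eq)
qed auto

text \<open>Common source of the closure under sums, multiples and squares. The Lipschitz estimate
  is asked only at values that \<open>f\<close> and \<open>h\<close> attain, so that squaring, which
  is not Lipschitz on the whole line, is covered on bounded ranges.\<close>

lemma RUCB_combine:
  assumes f: "f \<in> RUCB G T" and h: "h \<in> RUCB G T" and L: "0 \<le> L"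
    and \<Phi>: "\<And>x y. x \<in> carrier G \<Longrightarrow> y \<in> carrier G \<Longrightarrow>
      \<bar>\<Phi> (f x) (h x) - \<Phi> (f y) (h y)\<bar> \<le> L * (\<bar>f x - f y\<bar> + \<bar>h x - h y\<bar>)"
    and B: "\<And>x. x \<in> carrier G \<Longrightarrow> \<bar>\<Phi> (f x) (h x)\<bar> \<le> B"
  shows "(\<lambda>x\<in>carrier G. \<Phi> (f x) (h x)) \<in> RUCB G T"
proof (rule RUCB_I)
  fix \<epsilon> :: real assume "0 < \<epsilon>"
  \<comment> \<open>The factor 2 accounts for the two functions, and \<open>L + 1\<close> keeps the
    denominator positive when \<open>L = 0\<close>.\<close>
  define \<delta> where "\<delta> = \<epsilon> / (2 * (L + 1))"
  have pos: "0 < \<delta>" and \<epsilon>: "\<epsilon> = 2 * (L + 1) * \<delta>"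
    using L \<open>0 < \<epsilon>\<close> by (auto simp: \<delta>_def)
  obtain U where U: "neighborhood T \<one> U"
    "\<And>g x. g \<in> U \<Longrightarrow> x \<in> carrier G \<Longrightarrow> \<bar>f x - f (g \<otimes> x)\<bar> \<le> \<delta>"
    using RUCB_uniform[OF f pos] by blast
  obtain V where V: "neighborhood T \<one> V"
    "\<And>g x. g \<in> V \<Longrightarrow> x \<in> carrier G \<Longrightarrow> \<bar>h x - h (g \<otimes> x)\<bar> \<le> \<delta>"
    using RUCB_uniform[OF h pos] by blast
  have "\<bar>\<Phi> (f x) (h x) - \<Phi> (f (g \<otimes> x)) (h (g \<otimes> x))\<bar> \<le> \<epsilon>"
    if g: "g \<in> U" "g \<in> V" and x: "x \<in> carrier G" for g x
  proof -
    have gx: "g \<otimes> x \<in> carrier G" using neighborhood_carrier[OF U(1)] g x by auto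
    have "\<bar>\<Phi> (f x) (h x) - \<Phi> (f (g \<otimes> x)) (h (g \<otimes> x))\<bar>
        \<le> L * (\<bar>f x - f (g \<otimes> x)\<bar> + \<bar>h x - h (g \<otimes> x)\<bar>)"
      using \<Phi>[OF x gx] .
    also have "\<dots> \<le> L * (\<delta> + \<delta>)"
      using U(2) V(2) g x L by (intro mult_left_mono add_mono) auto
    also have "\<dots> \<le> \<epsilon>" using pos by (simp add: \<epsilon> algebra_simps)
    finally show ?thesis .
  qed
  then show "\<exists>U. neighborhood T \<one> U \<and>
      (\<forall>g\<in>U. \<forall>x\<in>carrier G. \<bar>\<Phi> (f x) (h x) - \<Phi> (f (g \<otimes> x)) (h (g \<otimes> x))\<bar> \<le> \<epsilon>)"
    using neighborhood_Int[OF U(1) V(1)] by blast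
qed (use B in auto)

lemma RUCB_add:
  assumes f: "f \<in> RUCB G T" and h: "h \<in> RUCB G T"
  shows "(\<lambda>x\<in>carrier G. f x + h x) \<in> RUCB G T"
proof -
  obtain B where B: "\<And>x. x \<in> carrier G \<Longrightarrow> \<bar>f x\<bar> \<le> B" using RUCB_bounded[OF f] by blast
  obtain C where C: "\<And>x. x \<in> carrier G \<Longrightarrow> \<bar>h x\<bar> \<le> C" using RUCB_bounded[OF h] by blast
  show ?thesis
    by (rule RUCB_combine[OF f h, of 1 "(+)" "B + C"])
      (use B C in \<open>force intro: order_trans[OF abs_triangle_ineq] add_mono\<close>)+
qed

lemma RUCB_scale:
  assumes f: "f \<in> RUCB G T"
  shows "(\<lambda>x\<in>carrier G. c * f x) \<in> RUCB G T"
proof -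
  obtain B where B: "\<And>x. x \<in> carrier G \<Longrightarrow> \<bar>f x\<bar> \<le> B" using RUCB_bounded[OF f] by blast
  show ?thesis
    by (rule RUCB_combine[OF f f, of "\<bar>c\<bar>" "\<lambda>a b. c * a" "\<bar>c\<bar> * B"])
      (use B in \<open>auto simp: abs_mult mult_left_mono simp flip: right_diff_distrib\<close>)
qed

lemma RUCB_square:
  assumes f: "f \<in> RUCB G T"
  shows "(\<lambda>x\<in>carrier G. (f x)\<^sup>2) \<in> RUCB G T"
proof -
  obtain B where B: "0 < B" "\<And>x. x \<in> carrier G \<Longrightarrow> \<bar>f x\<bar> \<le> B" using RUCB_bounded[OF f] by blast
  show ?thesis
  proof (rule RUCB_combine[OF f f, of B "\<lambda>a b. a\<^sup>2" "B\<^sup>2"])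
    fix x y assume xy: "x \<in> carrier G" "y \<in> carrier G"
    have "\<bar>(f x)\<^sup>2 - (f y)\<^sup>2\<bar> = \<bar>f x + f y\<bar> * \<bar>f x - f y\<bar>"
      by (simp add: power2_eq_square square_diff_square_factored abs_mult)
    also have "\<dots> \<le> (B + B) * \<bar>f x - f y\<bar>"
      using B(2)[OF xy(1)] B(2)[OF xy(2)] by (intro mult_right_mono) auto
    finally show "\<bar>(f x)\<^sup>2 - (f y)\<^sup>2\<bar> \<le> B * (\<bar>f x - f y\<bar> + \<bar>f x - f y\<bar>)"
      by (simp add: algebra_simps)
  next
    fix x assume x: "x \<in> carrier G"
    show "\<bar>(f x)\<^sup>2\<bar> \<le> B\<^sup>2" using B(2)[OF x] B(1) abs_le_square_iff[of "f x" B] by auto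
  qed (use B in auto)
qed

lemma RUCB_sum:
  assumes "finite I" "\<And>i. i \<in> I \<Longrightarrow> f i \<in> RUCB G T"
  shows "(\<lambda>x\<in>carrier G. \<Sum>i\<in>I. f i x) \<in> RUCB G T"
  using assms
proof (induction I rule: finite_induct)
  case empty
  then show ?case using RUCB_const[of 0] by (simp only: sum.empty)
next
  case (insert i I)
  have eq: "(\<lambda>x\<in>carrier G. \<Sum>i\<in>insert i I. f i x) =
      (\<lambda>x\<in>carrier G. f i x + (\<lambda>x\<in>carrier G. \<Sum>i\<in>I. f i x) x)"
    using insert by (intro restrict_ext) simp
  show ?case unfolding eq using insert by (intro RUCB_add) auto
qed

text \<open>Continuity of conjugation by \<open>x\<close> enters since \<open>x \<otimes> g \<otimes> h = (x \<otimes> g \<otimes> inv x) \<otimes> (x \<otimes> h)\<close>.\<close>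

lemma RUCB_translate_subgroup:
  assumes f: "f \<in> RUCB G T" and K: "subgroup K G" and x: "x \<in> carrier G"
  shows "(\<lambda>h\<in>K. f (x \<otimes> h)) \<in> RUCB (G\<lparr>carrier := K\<rparr>) (subtopology T K)"
proof -
  interpret K: topological_group "G\<lparr>carrier := K\<rparr>" "subtopology T K"
    using topological_group_subgroup[OF K] .
  have Kc: "h \<in> carrier G" if "h \<in> K" for h using that K by (rule subgroup.mem_carrier[rotated])
  obtain B where B: "\<And>x. x \<in> carrier G \<Longrightarrow> \<bar>f x\<bar> \<le> B" using RUCB_bounded[OF f] by blast
  have "(\<lambda>h\<in>carrier (G\<lparr>carrier := K\<rparr>). f (x \<otimes> h)) \<in> RUCB (G\<lparr>carrier := K\<rparr>) (subtopology T K)"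
  proof (rule K.RUCB_I)
    fix \<epsilon> :: real assume "0 < \<epsilon>"
    then obtain U where U: "neighborhood T \<one> U"
      "\<And>g y. g \<in> U \<Longrightarrow> y \<in> carrier G \<Longrightarrow> \<bar>f y - f (g \<otimes> y)\<bar> \<le> \<epsilon>"
      using RUCB_uniform[OF f] by blast
    obtain V where V: "openin T V" "\<one> \<in> V" "V \<subseteq> U" using U(1) by (auto simp: neighborhood_def)
    define W where "W = {g \<in> carrier G. x \<otimes> g \<otimes> inv x \<in> V} \<inter> K"
    have "openin (subtopology T K) W"
      unfolding W_def using openin_conjugation_preimage[OF x V(1)]
      by (auto intro: openin_subtopology_Int)
    moreover have "\<one> \<in> W" using x V K by (auto simp: W_def subgroup.one_closed)
    ultimately have "neighborhood (subtopology T K) \<one>\<^bsub>G\<lparr>carrier := K\<rparr>\<^esub> W"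
      unfolding neighborhood_def using openin_subset by force
    moreover have "\<bar>f (x \<otimes> h) - f (x \<otimes> (g \<otimes>\<^bsub>G\<lparr>carrier := K\<rparr>\<^esub> h))\<bar> \<le> \<epsilon>"
      if g: "g \<in> W" and h: "h \<in> K" for g h
    proof -
      have gc: "g \<in> carrier G" "x \<otimes> g \<otimes> inv x \<in> U" using g V by (auto simp: W_def)
      have "x \<otimes> g \<otimes> inv x \<otimes> (x \<otimes> h) = x \<otimes> g \<otimes> (inv x \<otimes> (x \<otimes> h))"
        using x gc Kc[OF h] by (simp add: m_assoc)
      also have "\<dots> = x \<otimes> (g \<otimes> h)" using x gc Kc[OF h] by (simp add: m_assoc flip: m_assoc[of "inv x"])
      finally show ?thesis using U(2)[OF gc(2), of "x \<otimes> h"] x Kc[OF h] by simp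
    qed
    ultimately show "\<exists>U. neighborhood (subtopology T K) \<one>\<^bsub>G\<lparr>carrier := K\<rparr>\<^esub> U \<and>
        (\<forall>g\<in>U. \<forall>h\<in>carrier (G\<lparr>carrier := K\<rparr>).
           \<bar>f (x \<otimes> h) - f (x \<otimes> (g \<otimes>\<^bsub>G\<lparr>carrier := K\<rparr>\<^esub> h))\<bar> \<le> \<epsilon>)"
      by auto
  qed (use B x Kc in auto)
  then show ?thesis by simp
qed

lemma RUCB_translate:
  assumes "f \<in> RUCB G T" "x \<in> carrier G"
  shows "(\<lambda>y\<in>carrier G. f (x \<otimes> y)) \<in> RUCB G T"
proof -
  have "subtopology T (carrier G) = T" by (metis subtopology_topspace topspace_eq)
  then show ?thesis using RUCB_translate_subgroup[OF assms(1) subgroup_self assms(2)] by simp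
qed

text \<open>By right-invariance \<open>d x (g \<otimes> x) = d \<one> g\<close> for every
  \<open>x\<close>. The open ball of radius \<open>\<epsilon>\<close> about the identity therefore
  serves as the required neighborhood, uniformly in \<open>x\<close>.\<close>

lemma RUCB_lipschitz:
  assumes d: "d \<in> Delta G T" and B: "\<And>x. x \<in> carrier G \<Longrightarrow> \<bar>f x\<bar> \<le> B"
    and lip: "\<And>x y. x \<in> carrier G \<Longrightarrow> y \<in> carrier G \<Longrightarrow> \<bar>f x - f y\<bar> \<le> d x y"
  shows "(\<lambda>x\<in>carrier G. f x) \<in> RUCB G T"
proof (rule RUCB_I)
  fix \<epsilon> :: real assume \<epsilon>: "0 < \<epsilon>"
  have "\<bar>f x - f (g \<otimes> x)\<bar> \<le> \<epsilon>"
    if "g \<in> carrier G" "d \<one> g < \<epsilon>" "x \<in> carrier G" for g x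
  proof -
    have "\<bar>f x - f (g \<otimes> x)\<bar> \<le> d (\<one> \<otimes> x) (g \<otimes> x)" using lip that by simp
    also have "\<dots> = d \<one> g" using d that one_closed unfolding Delta_def by blast
    finally show ?thesis using that by simp
  qed
  moreover have "neighborhood T \<one> {g \<in> carrier G. d \<one> g < \<epsilon>}"
    using pseudo_metric_ball_open[OF d one_closed \<epsilon>] d \<epsilon>
    by (auto simp: neighborhood_def topspace_eq Delta_def pseudo_metric_on_def)
  ultimately show "\<exists>U. neighborhood T \<one> U \<and>
      (\<forall>g\<in>U. \<forall>x\<in>carrier G. \<bar>f x - f (g \<otimes> x)\<bar> \<le> \<epsilon>)"
    by blast
qed (use B in auto)

section \<open>Invariant means\<close>

lemma mean_add:
  assumes "invariant_mean G T \<mu>" "f \<in> RUCB G T" "h \<in> RUCB G T"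
  shows "\<mu> (\<lambda>x\<in>carrier G. f x + h x) = \<mu> f + \<mu> h"
  using assms by (simp add: invariant_mean_def)

lemma mean_scale:
  assumes "invariant_mean G T \<mu>" "f \<in> RUCB G T"
  shows "\<mu> (\<lambda>x\<in>carrier G. c * f x) = c * \<mu> f"
  using assms by (simp add: invariant_mean_def)

lemma mean_nonneg:
  assumes "invariant_mean G T \<mu>" "f \<in> RUCB G T" "\<And>x. x \<in> carrier G \<Longrightarrow> 0 \<le> f x"
  shows "0 \<le> \<mu> f"
  using assms by (simp add: invariant_mean_def)

lemma mean_translate:
  assumes "invariant_mean G T \<mu>" "f \<in> RUCB G T" "g \<in> carrier G"
  shows "\<mu> (\<lambda>x\<in>carrier G. f (g \<otimes> x)) = \<mu> f"
  using assms by (simp add: invariant_mean_def)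

lemma mean_const:
  assumes \<mu>: "invariant_mean G T \<mu>"
  shows "\<mu> (\<lambda>x\<in>carrier G. c) = c"
proof -
  have "\<mu> (\<lambda>x\<in>carrier G. c * (\<lambda>x\<in>carrier G. 1) x) = c * \<mu> (\<lambda>x\<in>carrier G. 1)"
    by (rule mean_scale[OF \<mu> RUCB_const])
  also have "(\<lambda>x\<in>carrier G. c * (\<lambda>x\<in>carrier G. 1) x) = (\<lambda>x\<in>carrier G. c)"
    by (intro restrict_ext) simp
  also have "\<mu> (\<lambda>x\<in>carrier G. 1) = 1" using \<mu> unfolding invariant_mean_def by blast
  finally show ?thesis by (simp only: mult_1_right)
qed

lemma mean_mono:
  assumes \<mu>: "invariant_mean G T \<mu>" and f: "f \<in> RUCB G T" and h: "h \<in> RUCB G T"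
    and le: "\<And>x. x \<in> carrier G \<Longrightarrow> f x \<le> h x"
  shows "\<mu> f \<le> \<mu> h"
proof -
  let ?m = "\<lambda>x\<in>carrier G. (-1) * f x"
  have m: "?m \<in> RUCB G T" by (rule RUCB_scale[OF f])
  have "0 \<le> \<mu> (\<lambda>x\<in>carrier G. h x + ?m x)"
    by (rule mean_nonneg[OF \<mu> RUCB_add[OF h m]]) (use le in auto)
  also have "\<dots> = \<mu> h + (-1) * \<mu> f"
    unfolding mean_add[OF \<mu> h m] mean_scale[OF \<mu> f] ..
  finally show ?thesis by simp
qed

lemma mean_upper:
  assumes "invariant_mean G T \<mu>" "f \<in> RUCB G T" "\<And>x. x \<in> carrier G \<Longrightarrow> f x \<le> c"
  shows "\<mu> f \<le> c"
  using mean_mono[OF assms(1,2) RUCB_const[of c]] mean_const[OF assms(1)] assms(3) by simp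

lemma mean_lower:
  assumes "invariant_mean G T \<mu>" "f \<in> RUCB G T" "\<And>x. x \<in> carrier G \<Longrightarrow> c \<le> f x"
  shows "c \<le> \<mu> f"
  using mean_mono[OF assms(1) RUCB_const[of c] assms(2)] mean_const[OF assms(1)] assms(3) by simp

lemma mean_abs_diff_le:
  assumes \<mu>: "invariant_mean G T \<mu>" and f: "f \<in> RUCB G T" and h: "h \<in> RUCB G T"
    and le: "\<And>x. x \<in> carrier G \<Longrightarrow> \<bar>f x - h x\<bar> \<le> c"
  shows "\<bar>\<mu> f - \<mu> h\<bar> \<le> c"
proof -
  have *: "\<mu> a \<le> \<mu> b + c"
    if a: "a \<in> RUCB G T" and b: "b \<in> RUCB G T"
      and ab: "\<And>x. x \<in> carrier G \<Longrightarrow> a x \<le> b x + c" for a b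
  proof -
    have "\<mu> a \<le> \<mu> (\<lambda>x\<in>carrier G. b x + (\<lambda>x\<in>carrier G. c) x)"
      by (rule mean_mono[OF \<mu> a RUCB_add[OF b RUCB_const]]) (use ab in simp)
    also have "\<dots> = \<mu> b + c" unfolding mean_add[OF \<mu> b RUCB_const] mean_const[OF \<mu>] ..
    finally show ?thesis .
  qed
  have "f x \<le> h x + c" "h x \<le> f x + c" if "x \<in> carrier G" for x
    using le[OF that] by auto
  then show ?thesis using *[OF f h] *[OF h f] by fastforce
qed

lemma mean_sum:
  assumes \<mu>: "invariant_mean G T \<mu>" and "finite I" "\<And>i. i \<in> I \<Longrightarrow> f i \<in> RUCB G T"
  shows "\<mu> (\<lambda>x\<in>carrier G. \<Sum>i\<in>I. f i x) = (\<Sum>i\<in>I. \<mu> (f i))"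
  using assms(2,3)
proof (induction I rule: finite_induct)
  case empty
  then show ?case using mean_const[OF \<mu>, of 0] by (simp only: sum.empty)
next
  case (insert i I)
  have eq: "(\<lambda>x\<in>carrier G. \<Sum>i\<in>insert i I. f i x) =
      (\<lambda>x\<in>carrier G. f i x + (\<lambda>x\<in>carrier G. \<Sum>i\<in>I. f i x) x)"
    using insert by (intro restrict_ext) simp
  have "\<mu> (\<lambda>x\<in>carrier G. f i x + (\<lambda>x\<in>carrier G. \<Sum>i\<in>I. f i x) x) =
      \<mu> (f i) + \<mu> (\<lambda>x\<in>carrier G. \<Sum>i\<in>I. f i x)"
    using insert by (intro mean_add[OF \<mu>] RUCB_sum) auto
  also have "\<mu> (\<lambda>x\<in>carrier G. \<Sum>i\<in>I. f i x) = (\<Sum>i\<in>I. \<mu> (f i))"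
    by (rule insert.IH) (use insert.prems in simp)
  finally show ?case unfolding eq using insert.hyps by simp
qed

lemma RUCB_square_diff:
  assumes "f \<in> RUCB G T"
  shows "(\<lambda>x\<in>carrier G. (f x - c)\<^sup>2) \<in> RUCB G T"
  using RUCB_square[OF RUCB_add[OF assms RUCB_const[of "-c"]]] by (simp cong: restrict_cong)

text \<open>At \<open>c = \<mu> f\<close> the right-hand side collapses to the variance
  \<open>\<mu> (f\<^sup>2) - (\<mu> f)\<^sup>2\<close>, which is the form needed below.\<close>

lemma mean_square_diff:
  assumes \<mu>: "invariant_mean G T \<mu>" and f: "f \<in> RUCB G T"
  shows "\<mu> (\<lambda>x\<in>carrier G. (f x - c)\<^sup>2) = \<mu> (\<lambda>x\<in>carrier G. (f x)\<^sup>2) - 2 * c * \<mu> f + c\<^sup>2"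
proof -
  let ?a = "\<lambda>x\<in>carrier G. (- (2 * c)) * f x" and ?b = "\<lambda>x\<in>carrier G. c\<^sup>2"
    and ?s = "\<lambda>x\<in>carrier G. (f x)\<^sup>2"
  have m: "?a \<in> RUCB G T" "?b \<in> RUCB G T" "?s \<in> RUCB G T"
    by (rule RUCB_scale[OF f], rule RUCB_const, rule RUCB_square[OF f])
  have "\<mu> (\<lambda>x\<in>carrier G. (f x - c)\<^sup>2) = \<mu> (\<lambda>x\<in>carrier G. ?s x + (\<lambda>x\<in>carrier G. ?a x + ?b x) x)"
    by (intro arg_cong[of _ _ \<mu>] restrict_ext) (simp add: power2_eq_square algebra_simps)
  also have "\<dots> = \<mu> ?s + (\<mu> ?a + \<mu> ?b)"
    unfolding mean_add[OF \<mu> m(3) RUCB_add[OF m(1,2)]] mean_add[OF \<mu> m(1,2)] ..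
  also have "\<dots> = \<mu> ?s - 2 * c * \<mu> f + c\<^sup>2"
    unfolding mean_scale[OF \<mu> f] mean_const[OF \<mu>] by simp
  finally show ?thesis .
qed

text \<open>A mean lies between any lower and any upper bound of the function, so \<open>f x\<close>
  is within \<open>D\<close> of \<open>\<mu> f\<close> at every single point. Averaging the squared
  deviation gives the estimate.\<close>

lemma variance_le_oscillation:
  assumes \<mu>: "invariant_mean G T \<mu>" and f: "f \<in> RUCB G T"
    and D: "\<And>x y. x \<in> carrier G \<Longrightarrow> y \<in> carrier G \<Longrightarrow> \<bar>f x - f y\<bar> \<le> D"
  shows "\<mu> (\<lambda>x\<in>carrier G. (f x)\<^sup>2) - (\<mu> f)\<^sup>2 \<le> D\<^sup>2"
proof -
  have "(f x - \<mu> f)\<^sup>2 \<le> D\<^sup>2" if x: "x \<in> carrier G" for x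
  proof -
    have "f y \<le> f x + D" "f x - D \<le> f y" if "y \<in> carrier G" for y
      using D[OF x that] by auto
    then have "\<mu> f \<le> f x + D" "f x - D \<le> \<mu> f"
      by (auto intro: mean_upper[OF \<mu> f] mean_lower[OF \<mu> f])
    moreover have "0 \<le> D" using D[OF x x] by simp
    ultimately show ?thesis by (subst abs_le_square_iff[symmetric]) auto
  qed
  then have "\<mu> (\<lambda>x\<in>carrier G. (f x - \<mu> f)\<^sup>2) \<le> D\<^sup>2"
    by (intro mean_upper[OF \<mu> RUCB_square_diff[OF f]]) auto
  then show ?thesis
    unfolding mean_square_diff[OF \<mu> f] by (simp add: power2_eq_square)
qed

section \<open>Averaging over the left cosets of a subgroup\<close>

text \<open>The analogue of the conditional expectation onto functions constant on the left cosets
  \<open>x <# K\<close>, with an invariant mean on \<open>K\<close> instead of a Haar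
  measure.\<close>

definition coset_mean :: "'a set \<Rightarrow> (('a \<Rightarrow> real) \<Rightarrow> real) \<Rightarrow> ('a \<Rightarrow> real) \<Rightarrow> 'a \<Rightarrow> real" where
  "coset_mean K \<nu> f = (\<lambda>x\<in>carrier G. \<nu> (\<lambda>h\<in>K. f (x \<otimes> h)))"

context
  fixes K \<nu>
  assumes K: "subgroup K G"
    and \<nu>: "invariant_mean (G\<lparr>carrier := K\<rparr>) (subtopology T K) \<nu>"
begin

interpretation K: topological_group "G\<lparr>carrier := K\<rparr>" "subtopology T K"
  using topological_group_subgroup[OF K] .

lemma carrier_K: "carrier (G\<lparr>carrier := K\<rparr>) = K"
  by simp

lemma coset_mean_apply: "x \<in> carrier G \<Longrightarrow> coset_mean K \<nu> f x = \<nu> (\<lambda>h\<in>K. f (x \<otimes> h))"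
  by (simp add: coset_mean_def)

text \<open>Replacing \<open>x\<close> by \<open>x \<otimes> h\<close> turns the function
  \<open>k \<mapsto> f (x \<otimes> k)\<close> on \<open>K\<close> into its left translate by
  \<open>h\<close>, which has the same value under \<open>\<nu>\<close>.\<close>

lemma coset_mean_right_invariant:
  assumes f: "f \<in> RUCB G T" and x: "x \<in> carrier G" and h: "h \<in> K"
  shows "coset_mean K \<nu> f (x \<otimes> h) = coset_mean K \<nu> f x"
proof -
  have Kc: "k \<in> carrier G" if "k \<in> K" for k using that K by (rule subgroup.mem_carrier[rotated])
  have "\<nu> (\<lambda>k\<in>K. (\<lambda>k\<in>K. f (x \<otimes> k)) (h \<otimes> k)) = \<nu> (\<lambda>k\<in>K. f (x \<otimes> k))"
    using K.mean_translate[OF \<nu> RUCB_translate_subgroup[OF f K x], of h] h by simp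
  moreover have "(\<lambda>k\<in>K. (\<lambda>k\<in>K. f (x \<otimes> k)) (h \<otimes> k)) = (\<lambda>k\<in>K. f (x \<otimes> h \<otimes> k))"
    using x h Kc K by (intro restrict_ext) (simp add: m_assoc subgroup.m_closed)
  ultimately show ?thesis using x h Kc by (simp add: coset_mean_def)
qed

text \<open>The two cosets are compared point by point with the same \<open>h\<close>. The lemma
  yields both the right uniform continuity of the average and its Lipschitz estimate along a
  chain.\<close>

lemma coset_mean_diff_le:
  assumes f: "f \<in> RUCB G T" and x: "x \<in> carrier G" and y: "y \<in> carrier G"
    and le: "\<And>h. h \<in> K \<Longrightarrow> \<bar>f (x \<otimes> h) - f (y \<otimes> h)\<bar> \<le> c"
  shows "\<bar>coset_mean K \<nu> f x - coset_mean K \<nu> f y\<bar> \<le> c"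
  unfolding coset_mean_apply[OF x] coset_mean_apply[OF y]
  by (rule K.mean_abs_diff_le[OF \<nu> RUCB_translate_subgroup[OF f K x]
        RUCB_translate_subgroup[OF f K y]]) (use le in simp)

lemma coset_mean_lower:
  assumes "f \<in> RUCB G T" "x \<in> carrier G" "\<And>y. y \<in> carrier G \<Longrightarrow> c \<le> f y"
  shows "c \<le> coset_mean K \<nu> f x"
  unfolding coset_mean_apply[OF assms(2)]
  by (rule K.mean_lower[OF \<nu> RUCB_translate_subgroup[OF assms(1) K assms(2)]])
    (use assms K in \<open>auto simp: subgroup.mem_carrier\<close>)

lemma coset_mean_upper:
  assumes "f \<in> RUCB G T" "x \<in> carrier G" "\<And>y. y \<in> carrier G \<Longrightarrow> f y \<le> c"
  shows "coset_mean K \<nu> f x \<le> c"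
  unfolding coset_mean_apply[OF assms(2)]
  by (rule K.mean_upper[OF \<nu> RUCB_translate_subgroup[OF assms(1) K assms(2)]])
    (use assms K in \<open>auto simp: subgroup.mem_carrier\<close>)

text \<open>Left multiplication by \<open>g\<close> commutes with right multiplication by
  \<open>h\<close>, so a neighborhood that works for \<open>f\<close> works unchanged for the
  average.\<close>

lemma RUCB_coset_mean:
  assumes f: "f \<in> RUCB G T"
  shows "coset_mean K \<nu> f \<in> RUCB G T"
proof -
  obtain B where B: "\<And>x. x \<in> carrier G \<Longrightarrow> \<bar>f x\<bar> \<le> B" using RUCB_bounded[OF f] by blast
  have "(\<lambda>x\<in>carrier G. coset_mean K \<nu> f x) \<in> RUCB G T"
  proof (rule RUCB_I)
    fix x assume x: "x \<in> carrier G"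
    have "- B \<le> f y" "f y \<le> B" if "y \<in> carrier G" for y using B[OF that] by auto
    then have "- B \<le> coset_mean K \<nu> f x" "coset_mean K \<nu> f x \<le> B"
      using coset_mean_lower[OF f x] coset_mean_upper[OF f x] by auto
    then show "\<bar>coset_mean K \<nu> f x\<bar> \<le> B" by simp
  next
    fix \<epsilon> :: real assume "0 < \<epsilon>"
    then obtain U where U: "neighborhood T \<one> U"
      "\<And>g x. g \<in> U \<Longrightarrow> x \<in> carrier G \<Longrightarrow> \<bar>f x - f (g \<otimes> x)\<bar> \<le> \<epsilon>"
      using RUCB_uniform[OF f] by blast
    have "\<bar>coset_mean K \<nu> f x - coset_mean K \<nu> f (g \<otimes> x)\<bar> \<le> \<epsilon>"
      if g: "g \<in> U" and x: "x \<in> carrier G" for g x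
    proof (rule coset_mean_diff_le[OF f x])
      have gc: "g \<in> carrier G" using neighborhood_carrier[OF U(1) g] .
      then show "g \<otimes> x \<in> carrier G" using x by simp
      fix h assume h: "h \<in> K"
      have "h \<in> carrier G" using h K by (rule subgroup.mem_carrier[rotated])
      then show "\<bar>f (x \<otimes> h) - f (g \<otimes> x \<otimes> h)\<bar> \<le> \<epsilon>"
        using U(2)[OF g, of "x \<otimes> h"] gc x by (simp add: m_assoc)
    qed
    then show "\<exists>U. neighborhood T \<one> U \<and> (\<forall>g\<in>U. \<forall>x\<in>carrier G.
        \<bar>coset_mean K \<nu> f x - coset_mean K \<nu> f (g \<otimes> x)\<bar> \<le> \<epsilon>)"
      using U(1) by blast
  qed
  then show ?thesis by (simp add: coset_mean_def cong: restrict_cong)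
qed

text \<open>Averaging over \<open>K\<close> from the right is linear, positive and unital, and it
  commutes with left translation by elements of \<open>G\<close>. Hence every property of
  \<open>\<mu>\<close> passes to the composition.\<close>

lemma invariant_mean_coset_mean:
  assumes \<mu>: "invariant_mean G T \<mu>"
  shows "invariant_mean G T (\<lambda>f. \<mu> (coset_mean K \<nu> f))"
  unfolding invariant_mean_def
proof (intro conjI ballI allI impI)
  have Kc: "k \<in> carrier G" if "k \<in> K" for k using that K by (rule subgroup.mem_carrier[rotated])
  fix f assume f: "f \<in> RUCB G T"
  note tf = RUCB_translate_subgroup[OF f K]
  {
    fix h assume h: "h \<in> RUCB G T"
    have "coset_mean K \<nu> (\<lambda>x\<in>carrier G. f x + h x) =
        (\<lambda>x\<in>carrier G. coset_mean K \<nu> f x + coset_mean K \<nu> h x)"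
    proof (unfold coset_mean_def[of _ _ "\<lambda>x\<in>carrier G. f x + h x"], rule restrict_ext)
      fix x assume x: "x \<in> carrier G"
      have "(\<lambda>k\<in>K. (\<lambda>x\<in>carrier G. f x + h x) (x \<otimes> k)) =
          (\<lambda>k\<in>K. (\<lambda>k\<in>K. f (x \<otimes> k)) k + (\<lambda>k\<in>K. h (x \<otimes> k)) k)"
        using x Kc by (intro restrict_ext) simp
      then show "\<nu> (\<lambda>k\<in>K. (\<lambda>x\<in>carrier G. f x + h x) (x \<otimes> k)) =
          coset_mean K \<nu> f x + coset_mean K \<nu> h x"
        using K.mean_add[OF \<nu> tf[OF x] RUCB_translate_subgroup[OF h K x]] x
        by (simp only: coset_mean_apply carrier_K)
    qed
    then show "\<mu> (coset_mean K \<nu> (\<lambda>x\<in>carrier G. f x + h x)) =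
        \<mu> (coset_mean K \<nu> f) + \<mu> (coset_mean K \<nu> h)"
      by (simp only: mean_add[OF \<mu> RUCB_coset_mean[OF f] RUCB_coset_mean[OF h]])
  }
  {
    fix c
    have "coset_mean K \<nu> (\<lambda>x\<in>carrier G. c * f x) = (\<lambda>x\<in>carrier G. c * coset_mean K \<nu> f x)"
    proof (unfold coset_mean_def[of _ _ "\<lambda>x\<in>carrier G. c * f x"], rule restrict_ext)
      fix x assume x: "x \<in> carrier G"
      have "(\<lambda>k\<in>K. (\<lambda>x\<in>carrier G. c * f x) (x \<otimes> k)) = (\<lambda>k\<in>K. c * (\<lambda>k\<in>K. f (x \<otimes> k)) k)"
        using x Kc by (intro restrict_ext) simp
      then show "\<nu> (\<lambda>k\<in>K. (\<lambda>x\<in>carrier G. c * f x) (x \<otimes> k)) = c * coset_mean K \<nu> f x"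
        using K.mean_scale[OF \<nu> tf[OF x]] x by (simp only: coset_mean_apply carrier_K)
    qed
    then show "\<mu> (coset_mean K \<nu> (\<lambda>x\<in>carrier G. c * f x)) = c * \<mu> (coset_mean K \<nu> f)"
      by (simp only: mean_scale[OF \<mu> RUCB_coset_mean[OF f]])
  }
  {
    assume "\<forall>x\<in>carrier G. 0 \<le> f x"
    then show "0 \<le> \<mu> (coset_mean K \<nu> f)"
      by (intro mean_nonneg[OF \<mu> RUCB_coset_mean[OF f]] coset_mean_lower[OF f]) auto
  }
  {
    fix g assume g: "g \<in> carrier G"
    have "coset_mean K \<nu> (\<lambda>x\<in>carrier G. f (g \<otimes> x)) =
        (\<lambda>x\<in>carrier G. coset_mean K \<nu> f (g \<otimes> x))"
    proof (unfold coset_mean_def[of _ _ "\<lambda>x\<in>carrier G. f (g \<otimes> x)"], rule restrict_ext)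
      fix x assume x: "x \<in> carrier G"
      have "(\<lambda>k\<in>K. (\<lambda>x\<in>carrier G. f (g \<otimes> x)) (x \<otimes> k)) = (\<lambda>k\<in>K. f (g \<otimes> x \<otimes> k))"
        using x g Kc by (intro restrict_ext) (simp add: m_assoc)
      then show "\<nu> (\<lambda>k\<in>K. (\<lambda>x\<in>carrier G. f (g \<otimes> x)) (x \<otimes> k)) = coset_mean K \<nu> f (g \<otimes> x)"
        using x g by (simp add: coset_mean_apply)
    qed
    then show "\<mu> (coset_mean K \<nu> (\<lambda>x\<in>carrier G. f (g \<otimes> x))) = \<mu> (coset_mean K \<nu> f)"
      by (simp only: mean_translate[OF \<mu> RUCB_coset_mean[OF f] g])
  }
next
  have "coset_mean K \<nu> (\<lambda>x\<in>carrier G. 1) = (\<lambda>x\<in>carrier G. 1)"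
  proof (unfold coset_mean_def, rule restrict_ext)
    fix x assume x: "x \<in> carrier G"
    have "(\<lambda>h\<in>K. (\<lambda>x\<in>carrier G. 1 :: real) (x \<otimes> h)) = (\<lambda>h\<in>K. 1)"
      using x K by (intro restrict_ext) (auto simp: subgroup.mem_carrier)
    then show "\<nu> (\<lambda>h\<in>K. (\<lambda>x\<in>carrier G. 1) (x \<otimes> h)) = 1"
      using K.mean_const[OF \<nu>, of 1] by (simp only: carrier_K)
  qed
  then show "\<mu> (coset_mean K \<nu> (\<lambda>x\<in>carrier G. 1)) = 1"
    using mean_const[OF \<mu>, of 1] by (simp only:)
qed

end

section \<open>Concentration along a chain of amenable subgroups\<close>

lemma coset_dist_lower:
  assumes d: "d \<in> Delta G T" and H: "H \<subseteq> carrier G" and h: "h \<in> H"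
    and x: "x \<in> carrier G" and y: "y \<in> carrier G" and g: "g \<in> carrier G"
  shows "coset_dist G d H g x y \<le> d (g \<otimes> x) (g \<otimes> y \<otimes> h)"
  unfolding coset_dist_def
proof (rule cINF_lower[OF bdd_belowI2 h])
  show "0 \<le> d (g \<otimes> x) (g \<otimes> y \<otimes> k)" if "k \<in> H" for k
    using d x y g H that by (auto simp: Delta_def pseudo_metric_on_def subset_iff)
qed

text \<open>A single bound \<open>B\<close> for \<open>d\<close> dominates all coset distances,
  uniformly in \<open>x\<close>, \<open>y\<close> and \<open>g\<close>. This makes both nested real
  suprema genuine upper bounds.\<close>

lemma coset_dist_le_quotient_diam:
  assumes d: "d \<in> Delta G T" and H: "H \<subseteq> carrier G" "H \<noteq> {}" and K: "K \<subseteq> carrier G"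
    and x: "x \<in> K" and y: "y \<in> K" and g: "g \<in> carrier G"
  shows "coset_dist G d H g x y \<le> (SUP g\<in>carrier G. quotient_diam G d K H g)"
proof -
  obtain B where B: "\<forall>x\<in>carrier G. \<forall>y\<in>carrier G. d x y \<le> B" using d by (auto simp: Delta_def)
  obtain h where h: "h \<in> H" using H by blast
  have le: "coset_dist G d H g x y \<le> B" if "g \<in> carrier G" "x \<in> K" "y \<in> K" for g x y
    by (rule order_trans[OF coset_dist_lower[OF d H(1) h]]) (use that h H K B in \<open>auto simp: subset_iff\<close>)
  have "coset_dist G d H g x y \<le> quotient_diam G d K H g"
    unfolding quotient_diam_def
    by (rule cSUP_upper2[where x = "(x, y)"]) (use x y g le in \<open>auto intro!: bdd_aboveI2\<close>)
  also have "\<dots> \<le> (SUP g\<in>carrier G. quotient_diam G d K H g)"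
  proof (rule cSUP_upper[OF g bdd_aboveI2])
    fix g assume g: "g \<in> carrier G"
    show "quotient_diam G d K H g \<le> B"
      unfolding quotient_diam_def by (rule cSUP_least) (use x g le in auto)
  qed
  finally show ?thesis .
qed

text \<open>The translation \<open>g\<close> is what lets the bound be inherited. As
  \<open>d\<close> is only right-invariant, the restriction of a Lipschitz function to a coset
  \<open>x <# K\<close>, pulled back to \<open>K\<close>, is Lipschitz not for \<open>d\<close>
  itself but for \<open>d\<close> shifted by a left translation. The supremum over \<open>g\<close>
  in \<open>chain_length\<close> pays for this uniformity.\<close>

definition variance_bound ::
  "('a \<Rightarrow> 'a \<Rightarrow> real) \<Rightarrow> 'a set \<Rightarrow> (('a \<Rightarrow> real) \<Rightarrow> real) \<Rightarrow> real \<Rightarrow> bool" where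
  "variance_bound d K \<nu> s \<longleftrightarrow>
     (\<forall>g\<in>carrier G. \<forall>f\<in>RUCB (G\<lparr>carrier := K\<rparr>) (subtopology T K).
        (\<forall>a\<in>K. \<forall>b\<in>K. \<bar>f a - f b\<bar> \<le> d (g \<otimes> a) (g \<otimes> b)) \<longrightarrow>
        \<nu> (\<lambda>x\<in>K. (f x)\<^sup>2) - (\<nu> f)\<^sup>2 \<le> s)"

text \<open>This is the law of total variance for the composed mean: the variance of
  \<open>f\<close> is the mean of the variances on the cosets of \<open>K\<close>, at most
  \<open>s\<close>, plus the variance of the coset averages, at most
  \<open>D\<^sup>2\<close>.\<close>

lemma variance_bound_step:
  assumes d: "d \<in> Delta G T" and K: "subgroup K G" and K': "subgroup K' G" and sub: "K \<subseteq> K'"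
    and \<nu>: "invariant_mean (G\<lparr>carrier := K\<rparr>) (subtopology T K) \<nu>" and var: "variance_bound d K \<nu> s"
    and am: "amenable (G\<lparr>carrier := K'\<rparr>) (subtopology T K')"
  defines "D \<equiv> SUP g\<in>carrier G. quotient_diam G d K' K g"
  shows "\<exists>\<nu>'. invariant_mean (G\<lparr>carrier := K'\<rparr>) (subtopology T K') \<nu>' \<and>
           variance_bound d K' \<nu>' (s + D\<^sup>2)"
proof -
  interpret L: topological_group "G\<lparr>carrier := K'\<rparr>" "subtopology T K'"
    using topological_group_subgroup[OF K'] .
  have L_simps: "G\<lparr>carrier := K', carrier := K\<rparr> = G\<lparr>carrier := K\<rparr>"
    "subtopology (subtopology T K') K = subtopology T K"
    using sub by (simp_all add: subtopology_subtopology Int_absorb1)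
  have KL: "subgroup K (G\<lparr>carrier := K'\<rparr>)" using subgroup_incl[OF K K' sub] .
  have \<nu>L: "invariant_mean (G\<lparr>carrier := K', carrier := K\<rparr>) (subtopology (subtopology T K') K) \<nu>"
    using \<nu> unfolding L_simps .
  obtain \<mu> where \<mu>: "invariant_mean (G\<lparr>carrier := K'\<rparr>) (subtopology T K') \<mu>"
    using am unfolding amenable_iff_invariant_mean by blast
  have K'c: "x \<in> carrier G" if "x \<in> K'" for x using that K' by (rule subgroup.mem_carrier[rotated])
  let ?E = "L.coset_mean K \<nu>"
  have E: "?E f x = \<nu> (\<lambda>h\<in>K. f (x \<otimes> h))" if "x \<in> K'" for f x
    using L.coset_mean_apply[OF KL \<nu>L, of x f] that by simp
  have "variance_bound d K' (\<lambda>f. \<mu> (?E f)) (s + D\<^sup>2)"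
    unfolding variance_bound_def
  proof (intro ballI impI)
    fix g f assume g: "g \<in> carrier G" and f: "f \<in> RUCB (G\<lparr>carrier := K'\<rparr>) (subtopology T K')"
      and lip: "\<forall>a\<in>K'. \<forall>b\<in>K'. \<bar>f a - f b\<bar> \<le> d (g \<otimes> a) (g \<otimes> b)"
    let ?f2 = "\<lambda>x\<in>K'. (f x)\<^sup>2"
    have f2: "?f2 \<in> RUCB (G\<lparr>carrier := K'\<rparr>) (subtopology T K')" using L.RUCB_square[OF f] by simp
    note Ef = L.RUCB_coset_mean[OF KL \<nu>L f]
    have Ef2: "(\<lambda>x\<in>K'. (?E f x)\<^sup>2) \<in> RUCB (G\<lparr>carrier := K'\<rparr>) (subtopology T K')"
      using L.RUCB_square[OF Ef] by simp
    have cs: "(\<lambda>x\<in>K'. s) \<in> RUCB (G\<lparr>carrier := K'\<rparr>) (subtopology T K')"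
      using L.RUCB_const[of s] by simp
    \<comment> \<open>The bound on \<open>K\<close> is applied with the translation
      \<open>g \<otimes> x\<close> in place of \<open>g\<close>; associativity supplies the
      Lipschitz condition for \<open>h \<mapsto> f (x \<otimes> h)\<close>.\<close>
    have fibre: "?E ?f2 x \<le> (?E f x)\<^sup>2 + s" if x: "x \<in> K'" for x
    proof -
      have "\<nu> (\<lambda>h\<in>K. ((\<lambda>h\<in>K. f (x \<otimes> h)) h)\<^sup>2) - (\<nu> (\<lambda>h\<in>K. f (x \<otimes> h)))\<^sup>2 \<le> s"
      proof (rule var[unfolded variance_bound_def, rule_format])
        show "g \<otimes> x \<in> carrier G" using g x K'c by simp
        show "(\<lambda>h\<in>K. f (x \<otimes> h)) \<in> RUCB (G\<lparr>carrier := K\<rparr>) (subtopology T K)"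
          using L.RUCB_translate_subgroup[OF f KL, of x] x unfolding L_simps by simp
        show "\<bar>(\<lambda>h\<in>K. f (x \<otimes> h)) a - (\<lambda>h\<in>K. f (x \<otimes> h)) b\<bar> \<le> d (g \<otimes> x \<otimes> a) (g \<otimes> x \<otimes> b)"
          if "a \<in> K" "b \<in> K" for a b
        proof -
          have "x \<otimes> a \<in> K'" "x \<otimes> b \<in> K'"
            using x that sub K' by (auto intro: subgroup.m_closed)
          then show ?thesis using lip that x g sub K'c by (simp add: m_assoc subset_iff)
        qed
      qed
      moreover have "(\<lambda>h\<in>K. ((\<lambda>h\<in>K. f (x \<otimes> h)) h)\<^sup>2) = (\<lambda>h\<in>K. ?f2 (x \<otimes> h))"
        using x sub K' by (intro restrict_ext) (auto simp: subgroup.m_closed subset_iff)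
      ultimately show ?thesis by (simp add: E[OF x])
    qed
    \<comment> \<open>The average does not change when \<open>b\<close> is replaced by
      \<open>b \<otimes> h\<close>, and right-invariance of \<open>d\<close> cancels the common
      factor \<open>k\<close>. Taking the infimum over \<open>h\<close> in \<open>K\<close> produces
      the coset distance.\<close>
    have osc: "\<bar>?E f a - ?E f b\<bar> \<le> D" if a: "a \<in> K'" and b: "b \<in> K'" for a b
    proof -
      have "\<bar>?E f a - ?E f b\<bar> \<le> d (g \<otimes> a) (g \<otimes> b \<otimes> h)" if h: "h \<in> K" for h
      proof -
        have hK': "h \<in> K'" using h sub by auto
        have bh: "b \<otimes> h \<in> K'" using b hK' K' by (auto intro: subgroup.m_closed)
        have inv: "d (u \<otimes> w) (v \<otimes> w) = d u v"
          if "u \<in> carrier G" "v \<in> carrier G" "w \<in> carrier G" for u v w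
          using d that by (auto simp: Delta_def)
        have "\<bar>?E f a - ?E f (b \<otimes> h)\<bar> \<le> d (g \<otimes> a) (g \<otimes> (b \<otimes> h))"
        proof (rule L.coset_mean_diff_le[OF KL \<nu>L f])
          fix k assume k: "k \<in> K"
          then have kK': "k \<in> K'" using sub by auto
          have "\<bar>f (a \<otimes> k) - f (b \<otimes> h \<otimes> k)\<bar> \<le> d (g \<otimes> (a \<otimes> k)) (g \<otimes> (b \<otimes> h \<otimes> k))"
            using lip a bh kK' K' by (simp add: subgroup.m_closed)
          also have "\<dots> = d (g \<otimes> a) (g \<otimes> (b \<otimes> h))"
            using inv[of "g \<otimes> a" "g \<otimes> (b \<otimes> h)" k] g a bh kK' K'c by (simp add: m_assoc)
          finally show "\<bar>f (a \<otimes>\<^bsub>G\<lparr>carrier := K'\<rparr>\<^esub> k) - f (b \<otimes> h \<otimes>\<^bsub>G\<lparr>carrier := K'\<rparr>\<^esub> k)\<bar>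
            \<le> d (g \<otimes> a) (g \<otimes> (b \<otimes> h))" by simp
        qed (use a bh in auto)
        moreover have "?E f (b \<otimes> h) = ?E f b"
          using L.coset_mean_right_invariant[OF KL \<nu>L f, of b h] b h by simp
        ultimately show ?thesis using g b hK' K'c by (simp add: m_assoc)
      qed
      then have "\<bar>?E f a - ?E f b\<bar> \<le> coset_dist G d K g a b"
        unfolding coset_dist_def using subgroup.one_closed[OF K] by (intro cINF_greatest) auto
      also have "\<dots> \<le> D"
        unfolding D_def using subgroup.one_closed[OF K]
        by (intro coset_dist_le_quotient_diam[OF d subgroup.subset[OF K] _ subgroup.subset[OF K'] a b g])
          auto
      finally show ?thesis .
    qed
    \<comment> \<open>The coset estimate is averaged with \<open>\<mu>\<close>; the second moment of
      \<open>?E f\<close> is then compared with its squared mean through the oscillation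
      bound.\<close>
    have "\<mu> (?E ?f2) \<le> \<mu> (\<lambda>x\<in>K'. (\<lambda>x\<in>K'. (?E f x)\<^sup>2) x + (\<lambda>x\<in>K'. s) x)"
      by (rule L.mean_mono[OF \<mu> L.RUCB_coset_mean[OF KL \<nu>L f2]])
        (use L.RUCB_add[OF Ef2 cs] fibre in auto)
    also have "\<dots> = \<mu> (\<lambda>x\<in>K'. (?E f x)\<^sup>2) + s"
      using L.mean_add[OF \<mu> Ef2 cs] L.mean_const[OF \<mu>, of s] by simp
    also have "\<dots> \<le> D\<^sup>2 + (\<mu> (?E f))\<^sup>2 + s"
      using L.variance_le_oscillation[OF \<mu> Ef, of D] osc by simp
    finally show "\<mu> (?E ?f2) - (\<mu> (?E f))\<^sup>2 \<le> s + D\<^sup>2" by simp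
  qed
  then show ?thesis using L.invariant_mean_coset_mean[OF KL \<nu>L \<mu>] by blast
qed

text \<open>Induction along the chain. The first group is trivial, so functions on it have
  oscillation 0 and the bound is the empty sum. Each further group adds the squared diameter of one
  quotient.\<close>

lemma chain_variance_bound:
  assumes d: "d \<in> Delta G T" and Gs: "Gs \<in> amenable_chains G T" and i: "i < length Gs"
  shows "\<exists>\<nu>. invariant_mean (G\<lparr>carrier := Gs ! i\<rparr>) (subtopology T (Gs ! i)) \<nu> \<and>
    variance_bound d (Gs ! i) \<nu>
      (\<Sum>j<i. (SUP g\<in>carrier G. quotient_diam G d (Gs ! Suc j) (Gs ! j) g)\<^sup>2)"
proof -
  have mem: "subgroup (Gs ! j) G" "amenable (G\<lparr>carrier := Gs ! j\<rparr>) (subtopology T (Gs ! j))"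
    if "j < length Gs" for j
    using Gs nth_mem[OF that] by (auto simp: amenable_chains_def amenable_subgroups_def)
  show ?thesis using i
  proof (induction i)
    case 0
    have G0: "Gs ! 0 = {\<one>}" using Gs by (auto simp: amenable_chains_def hd_conv_nth)
    interpret K: topological_group "G\<lparr>carrier := Gs ! 0\<rparr>" "subtopology T (Gs ! 0)"
      using topological_group_subgroup[OF mem(1)[OF 0]] .
    obtain \<nu> where \<nu>: "invariant_mean (G\<lparr>carrier := Gs ! 0\<rparr>) (subtopology T (Gs ! 0)) \<nu>"
      using mem(2)[OF 0] unfolding amenable_iff_invariant_mean by blast
    have "variance_bound d (Gs ! 0) \<nu> 0"
      unfolding variance_bound_def using K.variance_le_oscillation[OF \<nu>, of _ 0] G0 by simp
    with \<nu> show ?case by auto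
  next
    case (Suc i)
    have "Gs ! i \<subseteq> Gs ! Suc i" using Gs Suc.prems by (auto simp: amenable_chains_def)
    then show ?case
      using Suc variance_bound_step[OF d mem(1)[of i] mem(1)[of "Suc i"]] mem(2)[of "Suc i"] by fastforce
  qed
qed

text \<open>A length below \<open>\<delta>\<close> is witnessed by one chain shorter than
  \<open>\<delta>\<close>. The variance bound at its last group, taken with the translation
  \<open>\<one>\<close>, is the claim, with one mean serving all Lipschitz functions at
  once.\<close>

lemma metric_amenable_length_concentration:
  assumes d: "d \<in> Delta G T" and \<delta>: "metric_amenable_length G T d < ennreal \<delta>"
  obtains \<mu> where "invariant_mean G T \<mu>"
    "\<And>f. f \<in> RUCB G T \<Longrightarrow> (\<And>x y. x \<in> carrier G \<Longrightarrow> y \<in> carrier G \<Longrightarrow> \<bar>f x - f y\<bar> \<le> d x y) \<Longrightarrow>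
      \<mu> (\<lambda>x\<in>carrier G. (f x)\<^sup>2) - (\<mu> f)\<^sup>2 \<le> \<delta>\<^sup>2"
proof -
  obtain Gs where Gs: "Gs \<in> amenable_chains G T" and len: "ennreal (chain_length G d Gs) < ennreal \<delta>"
    using \<delta> unfolding metric_amenable_length_def INF_less_iff by blast
  define s where
    "s = (\<Sum>j<length Gs - 1. (SUP g\<in>carrier G. quotient_diam G d (Gs ! Suc j) (Gs ! j) g)\<^sup>2)"
  \<comment> \<open>\<open>ennreal\<close> sends all negative reals to 0, so nonnegativity is
    required to recover an inequality between reals.\<close>
  have s0: "0 \<le> s" unfolding s_def by (intro sum_nonneg) auto
  then have "sqrt s < \<delta>"
    using len unfolding chain_length_def s_def[symmetric] by (simp add: ennreal_less_iff)
  then have "s \<le> \<delta>\<^sup>2" using s0 real_less_lsqrt real_sqrt_ge_zero[OF s0]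
    by (metis less_eq_real_def not_le order.strict_trans1 real_le_rsqrt)
  have ne: "Gs \<noteq> []" and last: "Gs ! (length Gs - 1) = carrier G"
    using Gs by (auto simp: amenable_chains_def last_conv_nth)
  have T: "subtopology T (carrier G) = T" by (metis subtopology_topspace topspace_eq)
  obtain \<mu> where \<mu>: "invariant_mean G T \<mu>" "variance_bound d (carrier G) \<mu> s"
    using chain_variance_bound[OF d Gs, of "length Gs - 1"] ne last
    by (auto simp: T s_def)
  show ?thesis
  proof (rule that[OF \<mu>(1)])
    fix f assume "f \<in> RUCB G T"
      "\<And>x y. x \<in> carrier G \<Longrightarrow> y \<in> carrier G \<Longrightarrow> \<bar>f x - f y\<bar> \<le> d x y"
    then have "\<mu> (\<lambda>x\<in>carrier G. (f x)\<^sup>2) - (\<mu> f)\<^sup>2 \<le> s"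
      using \<mu>(2)[unfolded variance_bound_def, rule_format, of \<one> f] by (simp add: T)
    then show "\<mu> (\<lambda>x\<in>carrier G. (f x)\<^sup>2) - (\<mu> f)\<^sup>2 \<le> \<delta>\<^sup>2" using \<open>s \<le> \<delta>\<^sup>2\<close> by simp
  qed
qed

section \<open>Almost invariant points\<close>

text \<open>The witness is the infimal convolution of \<open>f\<close> with \<open>d\<close>. Points
  at distance below 1 are controlled by the oscillation hypothesis; at distance at least 1 the term
  \<open>d x y\<close> alone exceeds \<open>f x - f y\<close>, as the values lie between 0 and 1.
  Hence the unit ball in \<open>T_set\<close> is the right scale.\<close>

lemma lipschitz_envelope:
  fixes f :: "'c \<Rightarrow> real"
  assumes d: "pseudo_metric_on S d"
    and f: "\<And>x. x \<in> S \<Longrightarrow> 0 \<le> f x \<and> f x \<le> 1"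
    and osc: "\<And>x y. x \<in> S \<Longrightarrow> y \<in> S \<Longrightarrow> d x y < 1 \<Longrightarrow> \<bar>f x - f y\<bar> \<le> \<epsilon>"
  shows "\<exists>p. \<forall>x\<in>S. 0 \<le> p x \<and> p x \<le> f x \<and> f x - \<epsilon> \<le> p x \<and> (\<forall>y\<in>S. \<bar>p x - p y\<bar> \<le> d x y)"
proof -
  define p where "p x = (INF y\<in>S. f y + d x y)" for x
  have d0: "0 \<le> d x y" "d x x = 0" "d x y = d y x" "d x z \<le> d x y + d y z"
    if "x \<in> S" "y \<in> S" "z \<in> S" for x y z
    using d that by (auto simp: pseudo_metric_on_def)
  have lower: "p x \<le> f y + d x y" if "x \<in> S" "y \<in> S" for x y
    unfolding p_def
    by (rule cINF_lower[OF bdd_belowI2[of _ 0]]) (use f d0 that in \<open>auto intro: add_nonneg_nonneg\<close>)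
  have greatest: "c \<le> p x" if "x \<in> S" "\<And>y. y \<in> S \<Longrightarrow> c \<le> f y + d x y" for c x
    unfolding p_def by (rule cINF_greatest) (use that in auto)
  have lip: "p x \<le> p y + d x y" if "x \<in> S" "y \<in> S" for x y
  proof -
    have "p x - d x y \<le> p y"
    proof (rule greatest)
      fix z assume z: "z \<in> S"
      show "p x - d x y \<le> f z + d y z" using lower[of x z] d0(4)[of x y z] z that by simp
    qed fact
    then show ?thesis by simp
  qed
  have "0 \<le> p x \<and> p x \<le> f x \<and> f x - \<epsilon> \<le> p x \<and> (\<forall>y\<in>S. \<bar>p x - p y\<bar> \<le> d x y)"
    if x: "x \<in> S" for x
  proof (intro conjI ballI)
    show "0 \<le> p x" using f d0 x by (intro greatest add_nonneg_nonneg) auto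
    show "p x \<le> f x" using lower[OF x x] d0[OF x x x] by simp
    have \<epsilon>: "0 \<le> \<epsilon>" using osc[OF x x] d0[OF x x x] by simp
    show "f x - \<epsilon> \<le> p x"
    proof (rule greatest[OF x])
      fix y assume y: "y \<in> S"
      show "f x - \<epsilon> \<le> f y + d x y"
      proof (cases "d x y < 1")
        case True
        then show ?thesis using osc[OF x y] d0(1)[OF x y y] by simp
      next
        case False
        then show ?thesis using f[OF x] f[OF y] \<epsilon> by simp
      qed
    qed
    show "\<bar>p x - p y\<bar> \<le> d x y" if y: "y \<in> S" for y
      using lip[OF x y] lip[OF y x] d0(3)[OF x y y] by simp
  qed
  then show ?thesis by blast
qed

text \<open>
  Each \<open>p i\<close> is nearly constant for the mean, hence so is its translate by \<open>h i\<close>, with the same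
  constant; the mean of the sum of the squared deviations is small, so it is small at some point.
\<close>

lemma almost_invariant_point_of_concentration:
  assumes d: "d \<in> Delta G T" and \<mu>: "invariant_mean G T \<mu>" and I: "finite I"
    and var: "\<And>f. f \<in> RUCB G T \<Longrightarrow>
      (\<And>x y. x \<in> carrier G \<Longrightarrow> y \<in> carrier G \<Longrightarrow> \<bar>f x - f y\<bar> \<le> d x y) \<Longrightarrow>
      \<mu> (\<lambda>x\<in>carrier G. (f x)\<^sup>2) - (\<mu> f)\<^sup>2 \<le> \<delta>\<^sup>2"
    and h: "\<And>i. i \<in> I \<Longrightarrow> h i \<in> carrier G"
    and p: "\<And>i x. i \<in> I \<Longrightarrow> x \<in> carrier G \<Longrightarrow> \<bar>p i x\<bar> \<le> 1"
    and lip: "\<And>i x y. i \<in> I \<Longrightarrow> x \<in> carrier G \<Longrightarrow> y \<in> carrier G \<Longrightarrow> \<bar>p i x - p i y\<bar> \<le> d x y"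
    and small: "4 * real (card I) * \<delta>\<^sup>2 < \<epsilon>\<^sup>2" and \<epsilon>: "0 < \<epsilon>"
  shows "\<exists>y\<in>carrier G. \<forall>i\<in>I. \<bar>p i (h i \<otimes> y) - p i y\<bar> < \<epsilon>"
proof -
  define P where "P i = (\<lambda>x\<in>carrier G. p i x)" for i
  define q where "q i = (\<lambda>x\<in>carrier G. (P i x - \<mu> (P i))\<^sup>2)" for i
  define r where "r i = (\<lambda>x\<in>carrier G. q i (h i \<otimes> x))" for i
  define S where "S = (\<lambda>x\<in>carrier G. \<Sum>i\<in>I. (\<lambda>x\<in>carrier G. r i x + q i x) x)"
  have P: "P i \<in> RUCB G T" if "i \<in> I" for i
    unfolding P_def using RUCB_lipschitz[OF d, of "p i" 1] p lip that by blast
  have q: "q i \<in> RUCB G T" if "i \<in> I" for i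
    unfolding q_def using RUCB_square_diff[OF P[OF that]] .
  have r: "r i \<in> RUCB G T" if "i \<in> I" for i
    unfolding r_def using RUCB_translate[OF q[OF that] h[OF that]] .
  have q\<mu>: "\<mu> (q i) \<le> \<delta>\<^sup>2" if i: "i \<in> I" for i
  proof -
    have "\<mu> (\<lambda>x\<in>carrier G. (P i x)\<^sup>2) - (\<mu> (P i))\<^sup>2 \<le> \<delta>\<^sup>2"
      by (rule var[OF P[OF i]]) (use lip i in \<open>simp add: P_def\<close>)
    then show ?thesis unfolding q_def mean_square_diff[OF \<mu> P[OF i]]
      by (simp add: power2_eq_square)
  qed
  have r\<mu>: "\<mu> (r i) = \<mu> (q i)" if i: "i \<in> I" for i
    unfolding r_def using mean_translate[OF \<mu> q[OF i] h[OF i]] .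
  have "\<mu> S = (\<Sum>i\<in>I. \<mu> (\<lambda>x\<in>carrier G. r i x + q i x))"
    unfolding S_def by (rule mean_sum[OF \<mu> I]) (use RUCB_add r q in blast)
  also have "\<dots> = (\<Sum>i\<in>I. \<mu> (q i) + \<mu> (q i))"
    using mean_add[OF \<mu> r q] r\<mu> by (intro sum.cong) auto
  also have "\<dots> \<le> (\<Sum>i\<in>I. \<delta>\<^sup>2 + \<delta>\<^sup>2)" using q\<mu> by (intro sum_mono add_mono)
  \<comment> \<open>Each index contributes \<open>2 * \<delta>\<^sup>2\<close>. The threshold
    \<open>\<epsilon>\<^sup>2 / 2\<close> is matched to the inequality
    \<open>(a - b)\<^sup>2 \<le> 2 * (a\<^sup>2 + b\<^sup>2)\<close> used at the end.\<close>
  also have "\<dots> < \<epsilon>\<^sup>2 / 2" using small by simp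
  finally have S\<mu>: "\<mu> S < \<epsilon>\<^sup>2 / 2" .
  have SR: "S \<in> RUCB G T" unfolding S_def by (intro RUCB_sum[OF I] RUCB_add r q)
  \<comment> \<open>Were \<open>S\<close> at least \<open>\<epsilon>\<^sup>2 / 2\<close> everywhere,
    its mean would be too.\<close>
  obtain y where y: "y \<in> carrier G" "S y < \<epsilon>\<^sup>2 / 2"
    using mean_lower[OF \<mu> SR, of "\<epsilon>\<^sup>2 / 2"] S\<mu> by force
  have "\<bar>p i (h i \<otimes> y) - p i y\<bar> < \<epsilon>" if i: "i \<in> I" for i
  proof -
    let ?a = "p i (h i \<otimes> y) - \<mu> (P i)" and ?b = "p i y - \<mu> (P i)"
    have "?a\<^sup>2 + ?b\<^sup>2 = (\<lambda>x\<in>carrier G. r i x + q i x) y"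
      using y(1) h[OF i] by (simp add: r_def q_def P_def)
    also have "\<dots> \<le> S y"
      unfolding S_def using y(1) h
      by (simp, intro member_le_sum[OF i _ I]) (auto simp: r_def q_def)
    finally have ab: "?a\<^sup>2 + ?b\<^sup>2 < \<epsilon>\<^sup>2 / 2" using y(2) by simp
    have "(a - b)\<^sup>2 \<le> 2 * (a\<^sup>2 + b\<^sup>2)" for a b :: real
      using zero_le_power2[of "a + b"] by (simp add: power2_eq_square algebra_simps)
    then have "(?a - ?b)\<^sup>2 \<le> 2 * (?a\<^sup>2 + ?b\<^sup>2)" .
    also have "\<dots> < \<epsilon>\<^sup>2" using ab by simp
    finally have "(?a - ?b)\<^sup>2 < \<epsilon>\<^sup>2" .
    then have "\<bar>?a - ?b\<bar> < \<bar>\<epsilon>\<bar>" using abs_le_square_iff[of \<epsilon> "?a - ?b"] by linarith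
    then show ?thesis using \<epsilon> by simp
  qed
  with y(1) show ?thesis by blast
qed

text \<open>The two conditions in \<open>T_set\<close> reduce the problem to a subgroup
  \<open>H\<close>. The covering condition writes \<open>g i = u i \<otimes> h i\<close> with
  \<open>u i\<close> in a small \<open>U\<close> and \<open>h i\<close> in \<open>H\<close>. The
  ball condition makes \<open>f i\<close> nearly constant on unit balls of \<open>H\<close>, hence
  close to a Lipschitz function, to which concentration applies.\<close>

lemma almost_invariant_point:
  assumes len: "amenable_length G T = 0" and I: "finite I"
    and f: "\<And>i. i \<in> I \<Longrightarrow> f i \<in> RUCB G T"
    and f01: "\<And>i x. i \<in> I \<Longrightarrow> x \<in> carrier G \<Longrightarrow> 0 \<le> f i x \<and> f i x \<le> 1"
    and g: "\<And>i. i \<in> I \<Longrightarrow> g i \<in> carrier G" and \<epsilon>: "0 < \<epsilon>"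
  shows "\<exists>y\<in>carrier G. \<forall>i\<in>I. \<bar>f i (g i \<otimes> y) - f i y\<bar> < \<epsilon>"
proof -
  \<comment> \<open>The final estimate adds four errors: passing from \<open>g i\<close> to
    \<open>h i\<close>, passing from \<open>f i\<close> to \<open>p i\<close> at each of the two
    points, and the displacement of \<open>p i\<close>.\<close>
  define e where "e = \<epsilon> / 4"
  have e: "0 < e" using \<epsilon> by (simp add: e_def)
  have "\<forall>i\<in>I. \<exists>U. neighborhood T \<one> U \<and>
      (\<forall>u\<in>U. \<forall>x\<in>carrier G. \<bar>f i x - f i (u \<otimes> x)\<bar> \<le> e)"
    using f e unfolding RUCB_iff by blast
  then obtain V where V: "\<And>i. i \<in> I \<Longrightarrow> neighborhood T \<one> (V i)"
    "\<And>i u x. i \<in> I \<Longrightarrow> u \<in> V i \<Longrightarrow> x \<in> carrier G \<Longrightarrow> \<bar>f i x - f i (u \<otimes> x)\<bar> \<le> e"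
    by metis
  obtain U where U: "neighborhood T \<one> U" "\<forall>i\<in>I. U \<subseteq> V i"
    using neighborhood_INT[OF I, of \<one> T V] V(1) by (auto simp: topspace_eq)
  define n where "n = real (card I)"
  \<comment> \<open>With this choice \<open>4 * n * \<delta>\<^sup>2\<close> equals
    \<open>e\<^sup>2 * n / (n + 1)\<^sup>2\<close>, which is below \<open>e\<^sup>2\<close> also for
    \<open>n = 0\<close>.\<close>
  define \<delta> where "\<delta> = e / (2 * (n + 1))"
  have n: "0 \<le> n" by (simp add: n_def)
  have \<delta>: "0 < \<delta>" and e\<delta>: "e = 2 * (n + 1) * \<delta>" using e n by (auto simp: \<delta>_def)
  have small: "4 * n * \<delta>\<^sup>2 < e\<^sup>2"
  proof -
    have "n < (n + 1)\<^sup>2" using n by (simp add: power2_eq_square algebra_simps add_pos_nonneg)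
    then have "4 * n * \<delta>\<^sup>2 < 4 * (n + 1)\<^sup>2 * \<delta>\<^sup>2" using \<delta> by simp
    also have "\<dots> = e\<^sup>2" unfolding e\<delta> power_mult_distrib by simp
    finally show ?thesis .
  qed
  \<comment> \<open>Since the supremum over all \<open>U\<close> and \<open>F\<close> vanishes, so
    does the infimum for this pair, and some \<open>(H, d)\<close> has length below
    \<open>\<delta>\<close>.\<close>
  have "(INF (H, d) \<in> T_set G T U (g ` I).
      metric_amenable_length (G\<lparr>carrier := H\<rparr>) (subtopology T H) d) \<le> amenable_length G T"
    unfolding amenable_length_def using U(1) I g
    by (intro SUP_upper2[of "(U, g ` I)"]) auto
  also have "\<dots> < ennreal \<delta>" using len \<delta> by simp
  finally obtain H d where Hd: "(H, d) \<in> T_set G T U (g ` I)"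
    and mal: "metric_amenable_length (G\<lparr>carrier := H\<rparr>) (subtopology T H) d < ennreal \<delta>"
    unfolding INF_less_iff by auto
  have H: "subgroup H G" and d: "d \<in> Delta (G\<lparr>carrier := H\<rparr>) (subtopology T H)"
    and cover: "g ` I \<subseteq> U <#> H" and ball: "{x \<in> H. d \<one> x < 1} \<subseteq> U"
    using Hd by (auto simp: T_set_def amenable_subgroups_def)
  interpret H: topological_group "G\<lparr>carrier := H\<rparr>" "subtopology T H"
    using topological_group_subgroup[OF H] .
  have Hc: "x \<in> carrier G" if "x \<in> H" for x using that H by (rule subgroup.mem_carrier[rotated])
  have "\<forall>i\<in>I. \<exists>u h. u \<in> U \<and> h \<in> H \<and> g i = u \<otimes> h"
    using cover unfolding set_mult_def by blast
  then obtain u h where uh: "\<And>i. i \<in> I \<Longrightarrow> u i \<in> U \<and> h i \<in> H \<and> g i = u i \<otimes> h i" by metis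
  have dp: "pseudo_metric_on H d" using d by (simp add: Delta_def)
  \<comment> \<open>The element \<open>y \<otimes> inv x\<close> carries \<open>x\<close> to
    \<open>y\<close>, and by right-invariance its distance from \<open>\<one>\<close> is
    \<open>d x y\<close>. It therefore lies in the unit ball, hence in \<open>U\<close>.\<close>
  have osc: "\<bar>f i x - f i y\<bar> \<le> e" if i: "i \<in> I" and xy: "x \<in> H" "y \<in> H" "d x y < 1" for i x y
  proof -
    have z: "y \<otimes> inv x \<in> H" using xy H by (simp add: subgroup.m_closed subgroup.m_inv_closed)
    have "d (\<one> \<otimes> x) (y \<otimes> inv x \<otimes> x) = d \<one> (y \<otimes> inv x)"
      using d z xy(1) subgroup.one_closed[OF H] by (simp add: Delta_def del: l_one)
    then have "d \<one> (y \<otimes> inv x) < 1" using xy Hc by (simp add: m_assoc)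
    then have "y \<otimes> inv x \<in> V i" using ball z U(2) i by auto
    from V(2)[OF i this, of x] show ?thesis using xy Hc by (simp add: m_assoc)
  qed
  have "\<forall>i\<in>I. \<exists>p. \<forall>x\<in>H. 0 \<le> p x \<and> p x \<le> f i x \<and> f i x - e \<le> p x \<and>
      (\<forall>y\<in>H. \<bar>p x - p y\<bar> \<le> d x y)"
    by (intro ballI lipschitz_envelope[OF dp] f01 osc) (use Hc in auto)
  then obtain p where p: "\<And>i x. i \<in> I \<Longrightarrow> x \<in> H \<Longrightarrow> 0 \<le> p i x \<and> p i x \<le> f i x \<and>
      f i x - e \<le> p i x \<and> (\<forall>y\<in>H. \<bar>p i x - p i y\<bar> \<le> d x y)"
    by metis
  obtain \<mu> where \<mu>: "invariant_mean (G\<lparr>carrier := H\<rparr>) (subtopology T H) \<mu>"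
    "\<And>f. f \<in> RUCB (G\<lparr>carrier := H\<rparr>) (subtopology T H) \<Longrightarrow>
      (\<And>x y. x \<in> carrier (G\<lparr>carrier := H\<rparr>) \<Longrightarrow> y \<in> carrier (G\<lparr>carrier := H\<rparr>) \<Longrightarrow>
        \<bar>f x - f y\<bar> \<le> d x y) \<Longrightarrow>
      \<mu> (\<lambda>x\<in>carrier (G\<lparr>carrier := H\<rparr>). (f x)\<^sup>2) - (\<mu> f)\<^sup>2 \<le> \<delta>\<^sup>2"
    using H.metric_amenable_length_concentration[OF d mal] by blast
  have "\<exists>y\<in>carrier (G\<lparr>carrier := H\<rparr>). \<forall>i\<in>I. \<bar>p i (h i \<otimes>\<^bsub>G\<lparr>carrier := H\<rparr>\<^esub> y) - p i y\<bar> < e"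
  proof (rule H.almost_invariant_point_of_concentration[OF d \<mu>(1) I \<mu>(2)])
    show "\<bar>p i x\<bar> \<le> 1" if "i \<in> I" "x \<in> carrier (G\<lparr>carrier := H\<rparr>)" for i x
      using p[of i x] f01[of i x] that Hc by fastforce
    show "4 * real (card I) * \<delta>\<^sup>2 < e\<^sup>2" using small by (simp add: n_def)
  qed (use p uh e in auto)
  then obtain y where y: "y \<in> H" "\<And>i. i \<in> I \<Longrightarrow> \<bar>p i (h i \<otimes> y) - p i y\<bar> < e" by auto
  have "\<bar>f i (g i \<otimes> y) - f i y\<bar> < \<epsilon>" if i: "i \<in> I" for i
  proof -
    have hy: "h i \<otimes> y \<in> H" using uh[OF i] y(1) H by (simp add: subgroup.m_closed)
    have "u i \<in> V i" "u i \<in> carrier G"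
      using uh[OF i] U i neighborhood_carrier by auto
    then have "\<bar>f i (h i \<otimes> y) - f i (g i \<otimes> y)\<bar> \<le> e"
      using V(2)[OF i, of "u i" "h i \<otimes> y"] hy uh[OF i] y(1) Hc by (simp add: m_assoc)
    moreover have "\<epsilon> = 4 * e" by (simp add: e_def)
    ultimately show ?thesis
      using p[OF i hy] p[OF i y(1)] y(2)[OF i] by (auto simp: abs_if split: if_splits)
  qed
  then show ?thesis using y(1) Hc by blast
qed

section \<open>Orbit maps on compact spaces and the fixed point\<close>

text \<open>In \<open>g \<otimes> x\<close> the factor \<open>g\<close> acts last, so it suffices
  that \<open>f (\<phi> g z)\<close> is close to \<open>f z\<close> for all \<open>z\<close> in
  \<open>X\<close> simultaneously. Compactness of \<open>X\<close> provides a neighborhood of such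
  \<open>g\<close> through the tube lemma.\<close>

lemma RUCB_orbit_map:
  assumes X: "compact_space X"
    and act: "group_action G (topspace X) \<phi>"
    and cont: "continuous_map (prod_topology T X) X (\<lambda>(g, x). \<phi> g x)"
    and f: "continuous_map X euclideanreal f"
    and f01: "\<And>x. x \<in> topspace X \<Longrightarrow> 0 \<le> f x \<and> f x \<le> 1" and x0: "x0 \<in> topspace X"
  shows "(\<lambda>g\<in>carrier G. f (\<phi> g x0)) \<in> RUCB G T"
proof (rule RUCB_I)
  interpret act: group_action G "topspace X" \<phi> by (rule act)
  fix g assume "g \<in> carrier G"
  then show "\<bar>f (\<phi> g x0)\<bar> \<le> 1" using f01[of "\<phi> g x0"] act.element_image x0 by fastforce
next
  interpret act: group_action G "topspace X" \<phi> by (rule act)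
  fix \<epsilon> :: real assume \<epsilon>: "0 < \<epsilon>"
  have one: "\<phi> \<one> x = x" if "x \<in> topspace X" for x
    using act.id_eq_one that by (metis restrict_apply')
  let ?F = "\<lambda>(g, x). f (\<phi> g x) - f x"
  have "continuous_map (prod_topology T X) euclideanreal (\<lambda>z. f (case z of (g, x) \<Rightarrow> \<phi> g x))"
    using continuous_map_compose[OF cont f] by (simp add: o_def)
  moreover have "continuous_map (prod_topology T X) euclideanreal (\<lambda>z. f (snd z))"
    using continuous_map_compose[OF continuous_map_snd f] by (simp add: o_def)
  ultimately have "continuous_map (prod_topology T X) euclideanreal ?F"
    unfolding case_prod_beta by (rule continuous_map_diff)
  then have op: "openin (prod_topology T X) {z \<in> topspace (prod_topology T X). ?F z \<in> {-\<epsilon><..<\<epsilon>}}"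
    by (rule openin_continuous_map_preimage) auto
  have sub: "{\<one>} \<times> topspace X \<subseteq> {z \<in> topspace (prod_topology T X). ?F z \<in> {-\<epsilon><..<\<epsilon>}}"
    using \<epsilon> one by (auto simp: topspace_eq)
  have "compactin X (topspace X)" "\<one> \<in> topspace T"
    using X by (auto simp: compact_space_def topspace_eq)
  from tube_lemma_right[OF op this sub] obtain U V where UV: "openin T U" "\<one> \<in> U" "topspace X \<subseteq> V"
    "U \<times> V \<subseteq> {z \<in> topspace (prod_topology T X). ?F z \<in> {-\<epsilon><..<\<epsilon>}}" by blast
  have "\<bar>f (\<phi> x x0) - f (\<phi> (g \<otimes> x) x0)\<bar> \<le> \<epsilon>" if g: "g \<in> U" and x: "x \<in> carrier G" for g x
  proof -
    have gc: "g \<in> carrier G" using g openin_subset[OF UV(1)] by (auto simp: topspace_eq)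
    have z: "\<phi> x x0 \<in> topspace X" using act.element_image[OF x x0] by blast
    have "(g, \<phi> x x0) \<in> {z \<in> topspace (prod_topology T X). ?F z \<in> {-\<epsilon><..<\<epsilon>}}"
      using UV g z by blast
    moreover have "\<phi> (g \<otimes> x) x0 = \<phi> g (\<phi> x x0)"
      using act.composition_rule[OF x0 gc x] .
    ultimately show ?thesis by auto
  qed
  moreover have "neighborhood T \<one> U"
    unfolding neighborhood_def using UV(1,2) openin_subset by blast
  ultimately show "\<exists>U. neighborhood T \<one> U \<and>
      (\<forall>g\<in>U. \<forall>x\<in>carrier G. \<bar>f (\<phi> x x0) - f (\<phi> (g \<otimes> x) x0)\<bar> \<le> \<epsilon>)"
    by blast
qed

end

theorem theorem4p12:
  fixes G :: "('a, 'b) monoid_scheme" and T :: "'a topology"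
  assumes "topological_group G T"
    and "amenable_length G T = 0"
  shows "extremely_amenable TYPE('x) G T"
  unfolding extremely_amenable_def
proof (intro allI impI, elim conjE)
  interpret topological_group G T by fact
  fix X :: "'x topology" and \<phi>
  assume X: "compact_space X" "Hausdorff_space X" "topspace X \<noteq> {}"
    and act: "group_action G (topspace X) \<phi>"
    and cont: "continuous_map (prod_topology T X) X (\<lambda>(g, x). \<phi> g x)"
  interpret act: group_action G "topspace X" \<phi> by (rule act)
  show "\<exists>x\<in>topspace X. \<forall>g\<in>carrier G. \<phi> g x = x"
  proof (rule ccontr)
    assume contra: "\<not> ?thesis"
    have \<phi>_cont: "continuous_map X X (\<phi> g)" if "g \<in> carrier G" for g
    proof -
      have "continuous_map X (prod_topology T X) (\<lambda>x. (g, x))"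
        using that by (intro continuous_map_pairedI) (auto simp: topspace_eq)
      from continuous_map_compose[OF this cont] show ?thesis by (simp add: o_def)
    qed
    \<comment> \<open>A moved point is separated from its image by a Urysohn function, with gap
      exactly 1. By continuity a gap above \<open>1 / 3\<close> persists on an open neighborhood;
      any constant strictly between 0 and 1 would serve.\<close>
    have "\<exists>g f W. g \<in> carrier G \<and> continuous_map X (top_of_set {0..1::real}) f \<and> openin X W \<and>
        x \<in> W \<and> (\<forall>z\<in>W. 1 / 3 < f (\<phi> g z) - f z)" if x: "x \<in> topspace X" for x
    proof -
      obtain g where g: "g \<in> carrier G" "\<phi> g x \<noteq> x" using contra x by blast
      have gx: "\<phi> g x \<in> topspace X" using act.element_image[OF g(1) x] by blast
      have "normal_space X" using X by (simp add: compact_Hausdorff_or_regular_imp_normal_space)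
      moreover have "closedin X {x}" "closedin X {\<phi> g x}"
        using X(2) x gx by (auto simp: closedin_Hausdorff_singleton)
      ultimately obtain f where f: "continuous_map X (top_of_set {0..1::real}) f"
        "f ` {x} \<subseteq> {0}" "f ` {\<phi> g x} \<subseteq> {1}"
        using Urysohn_lemma[of X "{x}" "{\<phi> g x}" 0 1] g(2) by (auto simp: disjnt_def)
      have fr: "continuous_map X euclideanreal f" using f(1) by (simp add: continuous_map_in_subtopology)
      have "continuous_map X euclideanreal (\<lambda>z. f (\<phi> g z) - f z)"
        using continuous_map_compose[OF \<phi>_cont[OF g(1)] fr] fr
        by (intro continuous_map_diff) (simp_all add: o_def)
      then have "openin X {z \<in> topspace X. f (\<phi> g z) - f z \<in> {1/3<..}}"
        by (rule openin_continuous_map_preimage) auto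
      then show ?thesis using f g(1) x
        by (intro exI[of _ g] exI[of _ f] exI[of _ "{z \<in> topspace X. f (\<phi> g z) - f z \<in> {1/3<..}}"]) auto
    qed
    then obtain g f W where gfW: "\<And>x. x \<in> topspace X \<Longrightarrow> g x \<in> carrier G \<and>
        continuous_map X (top_of_set {0..1::real}) (f x) \<and> openin X (W x) \<and>
        x \<in> W x \<and> (\<forall>z\<in>W x. 1 / 3 < f x (\<phi> (g x) z) - f x z)"
      by metis
    obtain I where I: "finite I" "I \<subseteq> topspace X" "topspace X \<subseteq> \<Union> (W ` I)"
    proof -
      have "\<exists>\<F>. finite \<F> \<and> \<F> \<subseteq> W ` topspace X \<and> topspace X \<subseteq> \<Union> \<F>"
        using X(1)[unfolded compact_space_def compactin_def] gfW by (elim conjE allE impE) auto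
      then show ?thesis using that by (metis finite_subset_image)
    qed
    obtain x0 where x0: "x0 \<in> topspace X" using X(3) by blast
    define F where "F i = (\<lambda>a\<in>carrier G. f i (\<phi> a x0))" for i
    have f01: "0 \<le> f i x \<and> f i x \<le> 1" if "i \<in> I" "x \<in> topspace X" for i x
      using gfW[of i] I that by (fastforce simp: continuous_map_in_subtopology)
    \<comment> \<open>The finitely many functions and group elements of the subcover are tested
      together along the orbit of \<open>x0\<close>.\<close>
    have "\<exists>y\<in>carrier G. \<forall>i\<in>I. \<bar>F i (g i \<otimes>\<^bsub>G\<^esub> y) - F i y\<bar> < 1 / 3"
    proof (rule almost_invariant_point[OF assms(2) I(1)])
      fix i assume i: "i \<in> I"
      then have "continuous_map X euclideanreal (f i)"
        using gfW[of i] I by (auto simp: continuous_map_in_subtopology)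
      then show "F i \<in> RUCB G T"
        unfolding F_def using RUCB_orbit_map[OF X(1) act cont] f01[OF i] x0 by blast
      show "g i \<in> carrier G" using gfW[of i] I i by blast
      show "0 \<le> F i a \<and> F i a \<le> 1" if "a \<in> carrier G" for a
        using f01[OF i, of "\<phi> a x0"] act.element_image[OF that x0] that by (auto simp: F_def)
    qed auto
    then obtain y where y: "y \<in> carrier G" "\<And>i. i \<in> I \<Longrightarrow> \<bar>F i (g i \<otimes>\<^bsub>G\<^esub> y) - F i y\<bar> < 1 / 3"
      by blast
    have "\<phi> y x0 \<in> topspace X" using act.element_image[OF y(1) x0] by blast
    \<comment> \<open>The almost invariant point of the orbit lies in some \<open>W i\<close> of the
      cover, where \<open>g i\<close> changes \<open>f i\<close> by more than
      \<open>1 / 3\<close>.\<close>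
    then obtain i where i: "i \<in> I" "\<phi> y x0 \<in> W i" using I(3) by blast
    have gi: "g i \<in> carrier G" and "1 / 3 < f i (\<phi> (g i) (\<phi> y x0)) - f i (\<phi> y x0)"
      using gfW[of i] i I(2) by blast+
    moreover have "\<phi> (g i \<otimes>\<^bsub>G\<^esub> y) x0 = \<phi> (g i) (\<phi> y x0)"
      using act.composition_rule[OF x0 gi y(1)] .
    ultimately show False using y(2)[OF i(1)] y(1) by (simp add: F_def)
  qed
qed

end
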